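(* Let $G$ be a simple subcubic graph (i.e., every vertex has degree at most $3$) that is $K_4$-minor-free. Then $R(G)\le 1$.
   Context: A graph $H$ is a minor of $G$ if a copy of $H$ can be obtained from $G$ by deleting and/or contracting edges; $G$ is $K_4$-minor-free if the complete graph $K_4$ is not a minor of $G$. For a simple graph $G$ of order $n$, let $\lambda_1(G)\ge\dots\ge\lambda_n(G)$ be the eigenvalues of its adjacency matrix, listed with multiplicity. The HL-index of $G$ is $R(G)=\max\{|\lambda_h(G)|,|\lambda_l(G)|\}$, where $h=\lfloor (n+1)/2\rfloor$ and $l=\lceil (n+1)/2\rceil$.
   Formalization: Minors here also allow deleting vertices (the standard notion); with only edge deletions and contractions, every disconnected graph would be K_4-minor-free and the claim would fail, e.g. for two disjoint Heawood graphs, where R(G) equals the square root of 2. *)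

theory Defs
  imports "Graph_Theory.Kuratowski" "Graph_Theory.Digraph_Isomorphism" "Jordan_Normal_Form.Char_Poly"
begin

text \<open>
  A simple graph is a \<^const>\<open>pair_graph\<close>: a finite vertex set \<^term>\<open>pverts G\<close> with a symmetric,
  irreflexive set \<^term>\<open>parcs G\<close> of ordered pairs, so that an edge \<open>uv\<close> is the pair of arcs
  \<open>(u, v)\<close>, \<open>(v, u)\<close>.
\<close>

definition subcubic :: "'a pair_pre_digraph \<Rightarrow> bool" where
  "subcubic G \<longleftrightarrow> (\<forall>v \<in> pverts G. out_degree (with_proj G) v \<le> 3)"


section \<open>Minors\<close>

definition delete_vertex :: "'a pair_pre_digraph \<Rightarrow> 'a \<Rightarrow> 'a pair_pre_digraph" where
  "delete_vertex G v =
     \<lparr> pverts = pverts G - {v}, parcs = {(x, y) \<in> parcs G. x \<noteq> v \<and> y \<noteq> v} \<rparr>"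

definition delete_edge :: "'a pair_pre_digraph \<Rightarrow> 'a \<Rightarrow> 'a \<Rightarrow> 'a pair_pre_digraph" where
  "delete_edge G u v = \<lparr> pverts = pverts G, parcs = parcs G - {(u, v), (v, u)} \<rparr>"

text \<open>
  Contracting \<open>uv\<close> identifies \<open>v\<close> with \<open>u\<close>. The result is again a simple graph: the loop created
  is dropped, and parallel edges merge because the arcs form a set.
\<close>

definition contract_edge :: "'a pair_pre_digraph \<Rightarrow> 'a \<Rightarrow> 'a \<Rightarrow> 'a pair_pre_digraph" where
  "contract_edge G u v =
     (let f = (\<lambda>x. if x = v then u else x)
      in \<lparr> pverts = f ` pverts G,
           parcs = {(f x, f y) | x y. (x, y) \<in> parcs G \<and> f x \<noteq> f y} \<rparr>)"

inductive minor_step :: "'a pair_pre_digraph \<Rightarrow> 'a pair_pre_digraph \<Rightarrow> bool" where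
  del_vertex: "v \<in> pverts G \<Longrightarrow> minor_step G (delete_vertex G v)"
| del_edge: "(u, v) \<in> parcs G \<Longrightarrow> minor_step G (delete_edge G u v)"
| contract: "(u, v) \<in> parcs G \<Longrightarrow> minor_step G (contract_edge G u v)"

definition is_minor :: "'b pair_pre_digraph \<Rightarrow> 'a pair_pre_digraph \<Rightarrow> bool" where
  "is_minor H G \<longleftrightarrow>
     (\<exists>G'. minor_step\<^sup>*\<^sup>* G G' \<and> digraph_iso (with_proj G') (with_proj H))"

definition K4_minor_free :: "'a pair_pre_digraph \<Rightarrow> bool" where
  "K4_minor_free G \<longleftrightarrow>
     \<not> (\<exists>H :: nat pair_pre_digraph. K\<^bsub>4\<^esub> (with_proj H) \<and> is_minor H G)"


section \<open>Adjacency eigenvalues and the HL-index\<close>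

definition adjacency_matrix :: "'a list \<Rightarrow> 'a pair_pre_digraph \<Rightarrow> real mat" where
  "adjacency_matrix vs G =
     mat (length vs) (length vs) (\<lambda>(i, j). if (vs ! i, vs ! j) \<in> parcs G then 1 else 0)"

definition vertex_list :: "'a pair_pre_digraph \<Rightarrow> 'a list" where
  "vertex_list G = (SOME vs. distinct vs \<and> set vs = pverts G)"

text \<open>
  The eigenvalues are the roots of the characteristic polynomial, with multiplicity. As the matrix
  is real symmetric, all \<open>n\<close> of them are real.
\<close>

definition graph_eigenvalues :: "'a pair_pre_digraph \<Rightarrow> real multiset" where
  "graph_eigenvalues G = proots (char_poly (adjacency_matrix (vertex_list G) G))"

text \<open>\<open>graph_lambda G k\<close> is the \<open>k\<close>-th largest eigenvalue, counting from \<open>k = 1\<close>.\<close>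

definition graph_lambda :: "'a pair_pre_digraph \<Rightarrow> nat \<Rightarrow> real" where
  "graph_lambda G k = rev (sorted_list_of_multiset (graph_eigenvalues G)) ! (k - 1)"

definition HL_index :: "'a pair_pre_digraph \<Rightarrow> real" where
  "HL_index G =
     (let n = card (pverts G);
          h = nat \<lfloor>(real n + 1) / 2\<rfloor>;
          l = nat \<lceil>(real n + 1) / 2\<rceil>
      in max \<bar>graph_lambda G h\<bar> \<bar>graph_lambda G l\<bar>)"

lemma adjacency_matrix_similar:
  assumes "distinct vs" "distinct ws" "set vs = set ws"
  shows "similar_mat (adjacency_matrix vs G) (adjacency_matrix ws G)"
proof -
  define n where "n = length vs"
  have ln: "length ws = n" using assms by (metis distinct_card n_def)
  define P :: "real mat" where "P = mat n n (\<lambda>(i, j). if vs ! i = ws ! j then 1 else 0)"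
  define Q :: "real mat" where "Q = mat n n (\<lambda>(i, j). if ws ! i = vs ! j then 1 else 0)"
  define f where "f i = (THE k. k < n \<and> ws ! k = vs ! i)" for i
  define g where "g i = (THE k. k < n \<and> vs ! k = ws ! i)" for i
  have f1: "\<exists>!k. k < n \<and> ws ! k = vs ! i" if "i < n" for i
    using that assms ln n_def by (metis in_set_conv_nth nth_eq_iff_index_eq)
  have g1: "\<exists>!k. k < n \<and> vs ! k = ws ! i" if "i < n" for i
    using that assms ln n_def by (metis in_set_conv_nth nth_eq_iff_index_eq)
  have f: "f i < n" "ws ! f i = vs ! i" if "i < n" for i
    using theI'[OF f1[OF that]] by (auto simp: f_def)
  have g: "g i < n" "vs ! g i = ws ! i" if "i < n" for i
    using theI'[OF g1[OF that]] by (auto simp: g_def)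
  have fe: "vs ! i = ws ! k \<longleftrightarrow> k = f i" if "i < n" "k < n" for i k
    using f[OF that(1)] that assms(2) ln by (metis nth_eq_iff_index_eq)
  have ge: "ws ! i = vs ! k \<longleftrightarrow> k = g i" if "i < n" "k < n" for i k
    using g[OF that(1)] that assms(1) n_def by (metis nth_eq_iff_index_eq)
  have gf: "g (f i) = i" if "i < n" for i
    using that f g ge by metis
  have fg: "f (g i) = i" if "i < n" for i
    using that f g fe by metis
  let ?A = "adjacency_matrix vs G" and ?B = "adjacency_matrix ws G"
  have c: "?A \<in> carrier_mat n n" "?B \<in> carrier_mat n n" "P \<in> carrier_mat n n" "Q \<in> carrier_mat n n"
    by (auto simp: adjacency_matrix_def P_def Q_def n_def ln)
  have P: "P $$ (i, k) = (if k = f i then 1 else 0)" if "i < n" "k < n" for i k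
    using that fe by (simp add: P_def)
  have Q: "Q $$ (i, k) = (if k = g i then 1 else 0)" if "i < n" "k < n" for i k
    using that ge by (simp add: Q_def)
  have mult: "(X * Y) $$ (i, j) = (\<Sum>k<n. X $$ (i, k) * Y $$ (k, j))"
    if "X \<in> carrier_mat n n" "Y \<in> carrier_mat n n" "i < n" "j < n" for X Y :: "real mat" and i j
    using that by (auto simp: scalar_prod_def lessThan_atLeast0)
  have PX: "(P * Y) $$ (i, j) = Y $$ (f i, j)"
    if "Y \<in> carrier_mat n n" "i < n" "j < n" for Y i j
    using that f[of i] by (simp add: mult[OF c(3)] P if_distrib[of "\<lambda>x. x * _"] sum.delta' cong: if_cong)
  have QX: "(Q * Y) $$ (i, j) = Y $$ (g i, j)"
    if "Y \<in> carrier_mat n n" "i < n" "j < n" for Y i j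
    using that g[of i] by (simp add: mult[OF c(4)] Q if_distrib[of "\<lambda>x. x * _"] sum.delta' cong: if_cong)
  have PQ: "P * Q = 1\<^sub>m n"
  proof (rule eq_matI)
    fix i j assume "i < dim_row (1\<^sub>m n)" "j < dim_col (1\<^sub>m n)"
    then show "(P * Q) $$ (i, j) = 1\<^sub>m n $$ (i, j)"
      using PX[OF c(4), of i j] Q[of "f i" j] f[of i] gf[of i] by (simp split: if_splits)
  qed (use c in auto)
  have QP: "Q * P = 1\<^sub>m n"
  proof (rule eq_matI)
    fix i j assume "i < dim_row (1\<^sub>m n)" "j < dim_col (1\<^sub>m n)"
    then show "(Q * P) $$ (i, j) = 1\<^sub>m n $$ (i, j)"
      using QX[OF c(3), of i j] P[of "g i" j] g[of i] fg[of i] by (simp split: if_splits)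
  qed (use c in auto)
  have "?A = P * (?B * Q)"
  proof (rule eq_matI)
    fix i j assume "i < dim_row (P * (?B * Q))" "j < dim_col (P * (?B * Q))"
    then have ij: "i < n" "j < n" using c by auto
    have "(P * (?B * Q)) $$ (i, j) = (?B * Q) $$ (f i, j)"
      using PX[of "?B * Q" i j] ij c by simp
    also have "\<dots> = (\<Sum>k<n. ?B $$ (f i, k) * Q $$ (k, j))"
      using mult[OF c(2,4)] f ij by blast
    also have "\<dots> = (\<Sum>k<n. if k = f j then ?B $$ (f i, k) else 0)"
      by (rule sum.cong) (use ij Q gf fg f in auto)
    also have "\<dots> = ?B $$ (f i, f j)" using f[OF ij(2)] by simp
    also have "\<dots> = ?A $$ (i, j)"
      using ij f ln by (simp add: adjacency_matrix_def n_def)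
    finally show "?A $$ (i, j) = (P * (?B * Q)) $$ (i, j)" by simp
  qed (use c in auto)
  also have "\<dots> = P * ?B * Q" using c by (simp add: assoc_mult_mat[of _ n n _ n _ n])
  finally show ?thesis
    using c PQ QP by (intro similar_matI[of _ _ P Q n]) auto
qed

lemma graph_eigenvalues_eq:
  assumes "distinct vs" "set vs = pverts G"
  shows "graph_eigenvalues G = proots (char_poly (adjacency_matrix vs G))"
proof -
  have "distinct (vertex_list G) \<and> set (vertex_list G) = pverts G"
    unfolding vertex_list_def by (rule someI[of _ vs]) (use assms in simp)
  then have "similar_mat (adjacency_matrix (vertex_list G) G) (adjacency_matrix vs G)"
    using assms adjacency_matrix_similar by metis
  then show ?thesis
    using char_poly_similar by (metis graph_eigenvalues_def)
qed

end

theory Submission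
  imports Defs "Jordan_Normal_Form.Schur_Decomposition" "Jordan_Normal_Form.Spectral_Radius"
begin

text \<open>
  It suffices that fewer than \<open>n/2\<close> eigenvalues are \<open>> 1\<close> and fewer than \<open>n/2\<close> are \<open>< -1\<close>. By the
  spectral theorem this holds if, for \<open>s = 1\<close> and \<open>s = -1\<close>, the inequality \<open>s x\<^sup>T A x \<le> x\<^sup>T x\<close> is valid
  on a subspace of codimension less than \<open>n/2\<close>. Such a subspace is built by induction on the graph.
  Let \<open>D\<close> be a set of vertices inducing a subgraph of maximum degree at most \<open>1\<close> whose set \<open>N\<close> of outer
  neighbours satisfies \<open>|N| \<le> |D|\<close>. Deleting \<open>D \<union> N\<close> and requiring \<open>x = 0\<close> on \<open>N\<close> costs codimension
  \<open>|N|\<close> and decouples \<open>D\<close> from the rest of the graph. If deleting leaves no vertex and \<open>|N| = |D|\<close>, the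
  graph has a spanning four-cycle (possibly with one chord) and a single linear condition is enough.

  Such a \<open>D\<close> exists whenever there is a vertex of degree at most \<open>1\<close>, two adjacent vertices of degree
  \<open>2\<close>, two vertices of degree \<open>2\<close> with the same neighbours, or a vertex of degree \<open>2\<close> in a triangle. If
  none of these occurs, suppressing the vertices of degree \<open>2\<close> yields a simple graph of minimum degree at
  least \<open>3\<close>, which has a \<open>K\<^sub>4\<close> minor by a theorem of Dirac.
\<close>

section \<open>Neighbourhoods and minors\<close>

definition nbrs :: "'a pair_pre_digraph \<Rightarrow> 'a \<Rightarrow> 'a set" where
  "nbrs G v = {w. (v, w) \<in> parcs G}"

definition delete_vertices :: "'a pair_pre_digraph \<Rightarrow> 'a set \<Rightarrow> 'a pair_pre_digraph" where
  "delete_vertices G X =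
     \<lparr> pverts = pverts G - X, parcs = {(x, y) \<in> parcs G. x \<notin> X \<and> y \<notin> X} \<rparr>"

lemma mem_nbrs: "w \<in> nbrs G v \<longleftrightarrow> (v, w) \<in> parcs G"
  by (simp add: nbrs_def)

lemma pair_graph_iff:
  "pair_graph G \<longleftrightarrow> finite (pverts G) \<and> parcs G \<subseteq> pverts G \<times> pverts G
     \<and> sym (parcs G) \<and> irrefl (parcs G)"
proof
  assume "pair_graph G"
  then interpret pair_graph G .
  show "finite (pverts G) \<and> parcs G \<subseteq> pverts G \<times> pverts G \<and> sym (parcs G) \<and> irrefl (parcs G)"
    using pair_finite_verts in_arcsD1 in_arcsD2 arcs_symmetric no_loops'
    by (fastforce simp: irrefl_def intro!: symI)
next
  assume A: "finite (pverts G) \<and> parcs G \<subseteq> pverts G \<times> pverts G \<and> sym (parcs G) \<and> irrefl (parcs G)"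
  then have "finite (parcs G)"
    by (meson finite_SigmaI finite_subset)
  with A show "pair_graph G"
    by unfold_locales (auto simp: symmetric_def irrefl_def)
qed

lemma nbrs_sym: "pair_graph G \<Longrightarrow> v \<in> nbrs G u \<longleftrightarrow> u \<in> nbrs G v"
  unfolding pair_graph_iff by (auto simp: nbrs_def dest: symD)

lemma nbrs_irrefl: "pair_graph G \<Longrightarrow> v \<notin> nbrs G v"
  unfolding pair_graph_iff by (auto simp: nbrs_def irrefl_def)

lemma nbrs_subset: "pair_graph G \<Longrightarrow> nbrs G v \<subseteq> pverts G"
  unfolding pair_graph_iff by (auto simp: nbrs_def)

lemma nbrs_vertex: "pair_graph G \<Longrightarrow> w \<in> nbrs G v \<Longrightarrow> v \<in> pverts G"
  using nbrs_sym nbrs_subset by fastforce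

lemma finite_nbrs: "pair_graph G \<Longrightarrow> finite (nbrs G v)"
  using nbrs_subset finite_subset pair_graph_iff by metis

lemma out_degree_eq_card_nbrs: "out_degree (with_proj G) v = card (nbrs G v)"
proof -
  have "out_arcs (with_proj G) v = Pair v ` nbrs G v"
    by (auto simp: out_arcs_def nbrs_def)
  then show ?thesis
    by (simp add: out_degree_def card_image inj_on_def)
qed

lemma K4_minor_free_step:
  assumes "K4_minor_free G" "minor_step G G'"
  shows "K4_minor_free G'"
  using assms unfolding K4_minor_free_def is_minor_def
  by (meson converse_rtranclp_into_rtranclp)

lemma pair_graph_delete_vertices: "pair_graph G \<Longrightarrow> pair_graph (delete_vertices G X)"
  unfolding pair_graph_iff by (auto simp: delete_vertices_def irrefl_def sym_def)

lemma pverts_delete_vertices [simp]: "pverts (delete_vertices G X) = pverts G - X"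
  by (simp add: delete_vertices_def)

lemma nbrs_delete_vertices: "v \<notin> X \<Longrightarrow> nbrs (delete_vertices G X) v = nbrs G v - X"
  by (auto simp: delete_vertices_def nbrs_def)

lemma K4_minor_free_delete_vertices:
  assumes "K4_minor_free G" "finite X" "X \<subseteq> pverts G"
  shows "K4_minor_free (delete_vertices G X)"
  using assms(2,3)
proof (induction X rule: finite_induct)
  case empty
  have "delete_vertices G {} = G" by (cases G) (auto simp: delete_vertices_def)
  then show ?case using assms(1) by simp
next
  case (insert v X)
  have "delete_vertices G (insert v X) = delete_vertex (delete_vertices G X) v"
    by (auto simp: delete_vertices_def delete_vertex_def)
  moreover have "v \<in> pverts (delete_vertices G X)"
    using insert by simp
  ultimately show ?case
    using insert K4_minor_free_step minor_step.del_vertex by (metis insert_subset)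
qed

text \<open>Deleting every vertex outside \<open>S\<close> leaves a complete graph on four vertices.
  It is copied onto \<open>{0..<4}\<close> because \<open>K4_minor_free\<close> ranges over graphs
  on natural numbers.\<close>

lemma K4_minor_free_no_clique:
  assumes G: "pair_graph G" and K: "K4_minor_free G"
    and S: "S \<subseteq> pverts G" "card S = 4" "\<And>x y. x \<in> S \<Longrightarrow> y \<in> S \<Longrightarrow> x \<noteq> y \<Longrightarrow> y \<in> nbrs G x"
  shows False
proof -
  define G' where "G' = delete_vertices G (pverts G - S)"
  have fV: "finite (pverts G)" using G pair_graph_iff by metis
  have K': "K4_minor_free G'"
    unfolding G'_def by (rule K4_minor_free_delete_vertices[OF K]) (use fV in auto)
  have G'g: "pair_graph G'"
    unfolding G'_def by (rule pair_graph_delete_vertices[OF G])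
  have V': "pverts G' = S" using S(1) by (auto simp: G'_def)
  have E': "parcs G' = {(x, y). x \<in> S \<and> y \<in> S \<and> x \<noteq> y}"
    using S(3) G S(1) unfolding pair_graph_iff
    by (auto simp: G'_def delete_vertices_def mem_nbrs irrefl_def)
  have fS: "finite S" using S(1) fV finite_subset by blast
  obtain f :: "'a \<Rightarrow> nat" where f: "bij_betw f S {0..<4}"
    using ex_bij_betw_finite_nat[OF fS] S(2) by auto
  define H :: "nat pair_pre_digraph" where
    "H = \<lparr> pverts = {0..<4}, parcs = {(x, y). x \<in> {0..<4} \<and> y \<in> {0..<4} \<and> x \<noteq> y} \<rparr>"
  have "K\<^bsub>4\<^esub> (with_proj H)"
    unfolding complete_digraph_pair_def by (auto simp: H_def)
  moreover have "digraph_iso (with_proj G') (with_proj H)"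
  proof -
    interpret G': pair_graph G' by fact
    define h :: "('a, 'a \<times> 'a, nat, nat \<times> nat) digraph_isomorphism" where
      "h = \<lparr> iso_verts = f, iso_arcs = map_prod f f, iso_head = snd, iso_tail = fst \<rparr>"
    have inj: "inj_on f S" and im: "f ` S = {0..<4}" using f by (auto simp: bij_betw_def)
    have "pre_digraph.digraph_isomorphism (with_proj G') h"
      unfolding pre_digraph.digraph_isomorphism_def
      using inj G'.wf_digraph_axioms by (auto simp: h_def V' E' inj_on_def)
    moreover have "with_proj H = app_iso h (with_proj G')"
    proof -
      have "map_prod f f ` {(x, y). x \<in> S \<and> y \<in> S \<and> x \<noteq> y}
          = {(x, y). x \<in> {0..<4} \<and> y \<in> {0..<4} \<and> x \<noteq> y}"
        unfolding im[symmetric] using inj by (auto simp: inj_on_def image_iff) 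
      then show ?thesis
        by (simp add: app_iso_def with_proj_def h_def H_def V' E' im)
    qed
    ultimately show ?thesis unfolding digraph_iso_def by blast
  qed
  ultimately show False
    using K' unfolding K4_minor_free_def is_minor_def by blast
qed

section \<open>Contraction of a single edge\<close>

lemma contract_edge:
  assumes G: "pair_graph G" and v: "v \<in> nbrs G u"
  defines "G' \<equiv> contract_edge G u v"
  shows pair_graph_contract: "pair_graph G'"
    and K4_minor_free_contract: "K4_minor_free G \<Longrightarrow> K4_minor_free G'"
    and pverts_contract: "pverts G' = pverts G - {v}"
    and nbrs_contract_merged: "nbrs G' u = (nbrs G u \<union> nbrs G v) - {u, v}"
    and nbrs_contract_other: "\<And>x. x \<noteq> u \<Longrightarrow> x \<noteq> v \<Longrightarrow>
          nbrs G' x = (if v \<in> nbrs G x then insert u (nbrs G x - {v}) else nbrs G x)"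
proof -
  have uv: "u \<noteq> v" "u \<in> pverts G" "v \<in> pverts G"
    using v nbrs_irrefl[OF G] nbrs_subset[OF G] nbrs_vertex[OF G] by auto
  define f where "f = (\<lambda>x. if x = v then u else x)"
  have G': "pverts G' = f ` pverts G"
    "parcs G' = {(f x, f y) | x y. (x, y) \<in> parcs G \<and> f x \<noteq> f y}"
    unfolding G'_def contract_edge_def f_def Let_def by simp_all
  show V': "pverts G' = pverts G - {v}"
    using uv by (auto simp: G' f_def)
  show "pair_graph G'"
    using G unfolding pair_graph_iff G' by (fastforce simp: irrefl_def sym_def)
  show "K4_minor_free G \<Longrightarrow> K4_minor_free G'"
    using K4_minor_free_step minor_step.contract v unfolding G'_def mem_nbrs by metis
  show "nbrs G' u = (nbrs G u \<union> nbrs G v) - {u, v}"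
    using uv by (auto simp: nbrs_def G' f_def)
  show "nbrs G' x = (if v \<in> nbrs G x then insert u (nbrs G x - {v}) else nbrs G x)"
    if "x \<noteq> u" "x \<noteq> v" for x
  proof -
    have fx: "f z = x \<longleftrightarrow> z = x" for z
      using \<open>x \<noteq> u\<close> \<open>x \<noteq> v\<close> by (auto simp: f_def)
    have "nbrs G' x = f ` nbrs G x"
    proof
      show "nbrs G' x \<subseteq> f ` nbrs G x"
      proof
        fix w assume "w \<in> nbrs G' x"
        then obtain a b where ab: "x = f a" "w = f b" "(a, b) \<in> parcs G"
          unfolding nbrs_def G' by blast
        then have "a = x" using fx by metis
        with ab show "w \<in> f ` nbrs G x" by (simp add: nbrs_def)
      qed
      show "f ` nbrs G x \<subseteq> nbrs G' x"
      proof
        fix w assume "w \<in> f ` nbrs G x"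
        then obtain b where b: "w = f b" "(x, b) \<in> parcs G"
          unfolding nbrs_def by blast
        then have "b \<noteq> x" using nbrs_irrefl[OF G, of x] by (auto simp: nbrs_def)
        then have "f x \<noteq> f b" "f x = x" using fx by metis+
        with b show "w \<in> nbrs G' x" unfolding nbrs_def G' by force
      qed
    qed
    then show ?thesis
      by (auto simp: f_def)
  qed
qed

text \<open>The edges from \<open>x\<close> to \<open>u\<close> and to \<open>v\<close> become one
  edge when both exist. Otherwise at most one neighbour is renamed, which leaves the degree
  alone.\<close>

lemma card_nbrs_contract:
  assumes G: "pair_graph G" and v: "v \<in> nbrs G u" and x: "x \<noteq> u" "x \<noteq> v"
  shows "card (nbrs (contract_edge G u v) x)
    = (if u \<in> nbrs G x \<and> v \<in> nbrs G x then card (nbrs G x) - 1 else card (nbrs G x))"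
proof -
  have fin: "finite (nbrs G x)" by (rule finite_nbrs[OF G])
  have "u \<noteq> v" using v nbrs_irrefl[OF G] by auto
  then show ?thesis
    using fin card_Suc_Diff1[OF fin, of v]
    by (auto simp: nbrs_contract_other[OF G v x] card_insert_if)
qed

section \<open>Reducible configurations\<close>

lemma clique4:
  assumes G: "pair_graph G" and K: "K4_minor_free G"
    and "b \<in> nbrs G a" "c \<in> nbrs G a" "d \<in> nbrs G a"
    and "c \<in> nbrs G b" "d \<in> nbrs G b" "d \<in> nbrs G c"
  shows False
proof (rule K4_minor_free_no_clique[OF G K])
  have ne: "a \<noteq> b" "a \<noteq> c" "a \<noteq> d" "b \<noteq> c" "b \<noteq> d" "c \<noteq> d"
    using assms(3-) nbrs_irrefl[OF G] by metis+
  then show "card {a, b, c, d} = 4" by simp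
  show "{a, b, c, d} \<subseteq> pverts G"
    using assms(3-) nbrs_vertex[OF G] nbrs_subset[OF G] by blast
  show "y \<in> nbrs G x" if "x \<in> {a, b, c, d}" "y \<in> {a, b, c, d}" "x \<noteq> y" for x y
    using that assms(3-) nbrs_sym[OF G] by blast
qed

lemma card_pverts_less:
  assumes "pair_graph G" "v \<in> pverts G" "pverts G' \<subseteq> pverts G - {v}"
  shows "card (pverts G') < card (pverts G)"
  using assms unfolding pair_graph_iff by (intro psubset_card_mono) auto

lemma card3_third:
  assumes "card A = 3" "p \<in> A" "q \<in> A" "p \<noteq> q"
  obtains r where "A = {p, q, r}" "r \<noteq> p" "r \<noteq> q"
proof -
  have "finite A" using assms(1) card.infinite by fastforce
  then have "card (A - {p, q}) = 1" using assms by (simp add: card_Diff_subset)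
  then obtain r where "A - {p, q} = {r}" by (auto simp: card_1_singleton_iff)
  then show thesis using that[of r] assms by blast
qed

lemma card2_second:
  assumes "card A = 2" "p \<in> A"
  obtains q where "A = {p, q}" "q \<noteq> p"
  using assms by (metis card_2_iff insert_commute insertE singletonD)

lemma card_insert_remove_swap:
  assumes "p \<in> A" "q \<notin> A" "finite A"
  shows "card (insert q (A - {p})) = card A"
  using assms card_Suc_Diff1[of A p] by simp

text \<open>
  The root \<open>z\<close> is exempt from the degree condition so that edges at \<open>z\<close> can be contracted freely. A
  contraction harms only common neighbours of degree \<open>3\<close>; if every contraction is blocked by one,
  then \<open>z\<close> and its blocking vertices carry a \<open>K\<^sub>4\<close> minor or have a part that collapses into \<open>z\<close>.
\<close>

lemma not_K4_minor_free_rooted: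
  assumes "pair_graph G" "z \<in> pverts G" "pverts G \<noteq> {z}"
    and "\<And>v. v \<in> pverts G \<Longrightarrow> v \<noteq> z \<Longrightarrow> 3 \<le> card (nbrs G v)"
  shows "\<not> K4_minor_free G"
  using assms
proof (induction "card (pverts G)" arbitrary: G z rule: less_induct)
  case less
  note G = less.prems(1) and z = less.prems(2) and deg = less.prems(4)
  note sym = nbrs_sym[OF G] and irr = nbrs_irrefl[OF G]
  have S: "v \<in> nbrs G u" if "u \<in> nbrs G v" for u v using that sym by blast
  show ?case
  proof
    assume K: "K4_minor_free G"
    have IH: False if "pair_graph H" "K4_minor_free H" "pverts H \<subseteq> pverts G" "card (pverts H) < card (pverts G)"
      "y \<in> pverts H" "y \<noteq> r" "r \<in> pverts H" "\<And>v. v \<in> pverts H \<Longrightarrow> v \<noteq> r \<Longrightarrow> 3 \<le> card (nbrs H v)" for H r y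
      using less.hyps[of H r] that by blast
    have smaller: "card (pverts H) < card (pverts G)" if "pverts H \<subseteq> pverts G - {v}" "v \<in> pverts G" for H v
      using card_pverts_less[OF G that(2) that(1)] .
    show False
    proof (cases "nbrs G z = {}")
      \<comment> \<open>An isolated root can be deleted without affecting any other degree. Any
        other vertex \<open>r\<close> then serves as root, and its neighbour \<open>y\<close> shows
        that \<open>r\<close> is not alone.\<close>
      case True
      let ?H = "delete_vertices G {z}"
      obtain r where r: "r \<in> pverts G" "r \<noteq> z" using less.prems by blast
      obtain y where y: "y \<in> nbrs G r" using deg[OF r] by fastforce
      have nb: "nbrs ?H v = nbrs G v" if "v \<noteq> z" for v
      proof -
        have "z \<notin> nbrs G v" using True S by blast
        then show ?thesis using that by (simp add: nbrs_delete_vertices)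
      qed
      show False
      proof (rule IH[of ?H y r])
        show "K4_minor_free ?H" using K4_minor_free_delete_vertices[OF K, of "{z}"] z by simp
        show "y \<in> pverts ?H" proof -
          have "y \<in> pverts G" using y nbrs_subset[OF G] by blast
          moreover have "y \<noteq> z" using y True S by blast
          ultimately show ?thesis by simp
        qed
        show "y \<noteq> r" using y irr by blast
        show "3 \<le> card (nbrs ?H v)" if "v \<in> pverts ?H" "v \<noteq> r" for v
          using that nb deg by simp
      qed (use pair_graph_delete_vertices[OF G] smaller[of ?H z] z r in auto)
    next
      case False
      then obtain w where w: "w \<in> nbrs G z" by blast
      have wV: "w \<in> pverts G" "w \<noteq> z" "z \<in> nbrs G w"
        using w nbrs_subset[OF G] irr S by blast+
      \<comment> \<open>The induction hypothesis with the same root rules out every safe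
        contraction. Only common neighbours of \<open>u\<close> and \<open>v\<close> lose a degree,
        and the merged vertex needs a check of its own unless it is \<open>z\<close>.\<close>
      have contract: False if e: "v \<in> nbrs G u" "v \<noteq> z"
        and bound: "\<And>x. x \<in> nbrs G u \<Longrightarrow> x \<in> nbrs G v \<Longrightarrow> x \<noteq> z \<Longrightarrow> 4 \<le> card (nbrs G x)"
        and u: "u \<noteq> z \<Longrightarrow> 3 \<le> card ((nbrs G u \<union> nbrs G v) - {u, v})" for u v
      proof -
        let ?H = "contract_edge G u v"
        note H = pair_graph_contract[OF G e(1)] K4_minor_free_contract[OF G e(1) K] pverts_contract[OF G e(1)]
        have vu: "v \<in> pverts G" "u \<in> pverts G" "u \<noteq> v" using e nbrs_subset[OF G] nbrs_vertex[OF G] irr by blast+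
        have "3 \<le> card (nbrs G v)" using deg vu e by blast
        have "\<not> pverts G \<subseteq> {z, v}"
        proof
          assume "pverts G \<subseteq> {z, v}"
          then have "nbrs G v \<subseteq> {z}" using nbrs_subset[OF G, of v] irr[of v] by blast
          then have "card (nbrs G v) \<le> card {z}" by (intro card_mono) auto
          with \<open>3 \<le> card (nbrs G v)\<close> show False by simp
        qed
        then obtain y where y: "y \<in> pverts G" "y \<noteq> z" "y \<noteq> v" by blast
        show False
        proof (rule IH[OF H(1,2), of y z])
          show "3 \<le> card (nbrs ?H x)" if x: "x \<in> pverts ?H" "x \<noteq> z" for x
          proof (cases "x = u")
            case True
            then show ?thesis using u x nbrs_contract_merged[OF G e(1)] by simp
          next
            case False
            moreover have "x \<noteq> v" "x \<in> pverts G" using x H(3) by auto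
            ultimately show ?thesis
              using card_nbrs_contract[OF G e(1), of x] deg[of x] bound[of x] x(2)
                sym[of x u] sym[of x v] by auto
          qed
        qed (use H(3) z e vu y smaller[of ?H v] in auto)
      qed
      \<comment> \<open>Contraction of \<open>zw\<close> into the root must be blocked by a common
        neighbour of degree \<open>3\<close>.\<close>
      have "\<exists>x. x \<in> nbrs G z \<and> x \<in> nbrs G w \<and> x \<noteq> z \<and> card (nbrs G x) < 4"
      proof (rule ccontr)
        assume "\<not> ?thesis"
        then have "4 \<le> card (nbrs G x)" if "x \<in> nbrs G z" "x \<in> nbrs G w" "x \<noteq> z" for x
          using that by (meson not_less)
        then show False using contract[OF w] wV by blast
      qed
      then obtain x where x: "x \<in> nbrs G z" "x \<in> nbrs G w" "x \<noteq> z" "card (nbrs G x) < 4"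
        by blast
      have xV: "x \<in> pverts G" "x \<noteq> w" using x nbrs_subset[OF G] irr by blast+
      have "card (nbrs G x) = 3" using deg[OF xV(1) x(3)] x by simp
      then obtain y where y: "nbrs G x = {z, w, y}" "y \<noteq> z" "y \<noteq> w"
        using card3_third[of "nbrs G x" z w] S[OF x(1)] S[OF x(2)] wV(2) by metis
      have yV: "y \<in> pverts G" "y \<noteq> x" "x \<in> nbrs G y" using y nbrs_subset[OF G] irr S by blast+
      \<comment> \<open>If the edge \<open>wy\<close> were missing, \<open>x\<close> could be
        contracted into \<open>w\<close>: the merged vertex trades the neighbour \<open>x\<close>
        for \<open>y\<close>, and \<open>z\<close> is the only common neighbour.\<close>
      have yw: "y \<in> nbrs G w"
      proof (rule ccontr)
        assume n: "y \<notin> nbrs G w"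
        have "(nbrs G w \<union> nbrs G x) - {w, x} = insert y (nbrs G w - {x})"
          using y x yV wV irr[of w] by auto
        moreover have "card \<dots> = card (nbrs G w)"
          using card_insert_remove_swap[OF x(2) n] finite_nbrs[OF G] by blast
        ultimately have "3 \<le> card ((nbrs G w \<union> nbrs G x) - {w, x})"
          using deg wV by simp
        moreover have "4 \<le> card (nbrs G t)" if "t \<in> nbrs G w" "t \<in> nbrs G x" "t \<noteq> z" for t
          using that y n irr[of w] by auto
        ultimately show False using contract[of x w] x by blast
      qed
      have yz: "y \<notin> nbrs G z"
        using clique4[OF G K w x(1)] x(2) yw y(1) by blast
      \<comment> \<open>Since \<open>y\<close> is not adjacent to \<open>z\<close>, the only common
        neighbour of \<open>z\<close> and \<open>x\<close> is \<open>w\<close>; if its degree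
        exceeded \<open>3\<close>, contraction of \<open>zx\<close> would be safe.\<close>
      have "card (nbrs G w) = 3"
      proof (rule ccontr)
        assume "card (nbrs G w) \<noteq> 3"
        then have "4 \<le> card (nbrs G w)" using deg[OF wV(1,2)] by simp
        then have "4 \<le> card (nbrs G t)" if "t \<in> nbrs G z" "t \<in> nbrs G x" "t \<noteq> z" for t
          using that y yz by auto
        then show False using contract[of x z] x by blast
      qed
      then have Nw: "nbrs G w = {z, x, y}"
        using card3_third[of "nbrs G w" z x] x wV yw y by (metis insert_iff singletonD yV(2))
      \<comment> \<open>Now \<open>x\<close> and \<open>w\<close> have no neighbours outside
        \<open>{z, w, x, y}\<close>. Collapsing both into \<open>z\<close> replaces the two edges
        from \<open>y\<close> to them by one edge to \<open>z\<close> and changes no other degree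
        away from the root.\<close>
      let ?G1 = "contract_edge G z x"
      note G1 = pair_graph_contract[OF G x(1)] K4_minor_free_contract[OF G x(1) K] pverts_contract[OF G x(1)]
      note n1 = nbrs_contract_other[OF G x(1)]
      have N1w: "nbrs ?G1 w = {z, y}" using n1[of w] wV xV x Nw y yV by auto
      have N1y: "nbrs ?G1 y = insert z (nbrs G y - {x})" using n1[of y] y yV by auto
      have N1: "nbrs ?G1 v = nbrs G v" if "v \<notin> {x, z, w, y}" for v
        using n1[of v] that y sym[of v x] by auto
      have w1: "w \<in> nbrs ?G1 z"
        unfolding nbrs_sym[OF G1(1), of w] using N1w by simp
      let ?G2 = "contract_edge ?G1 z w"
      note G2 = pair_graph_contract[OF G1(1) w1] K4_minor_free_contract[OF G1(1) w1 G1(2)] pverts_contract[OF G1(1) w1]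
      note n2 = nbrs_contract_other[OF G1(1) w1]
      have wy: "w \<in> nbrs G y" using S[OF yw] .
      have N2y: "nbrs ?G2 y = insert z (nbrs G y - {x, w})"
        using n2[of y] y N1y wy xV by auto
      have N2: "nbrs ?G2 v = nbrs G v" if "v \<notin> {x, z, w, y}" for v
        using n2[of v] N1[of v] that Nw sym[of v w] by auto
      have V2: "pverts ?G2 = pverts G - {x, w}" using G2(3) G1(3) by auto
      have zy: "z \<notin> nbrs G y" using yz S by blast
      have cNy: "card (nbrs G y - {x, w}) = card (nbrs G y) - 2"
        using wy yV xV finite_nbrs[OF G] by (subst card_Diff_subset) auto
      then have c2y: "card (nbrs ?G2 y) = card (nbrs G y) - 1"
        using N2y zy finite_nbrs[OF G, of y] deg[OF yV(1) y(2)] by simp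
      \<comment> \<open>The collapse costs \<open>y\<close> one degree, so it can be blocked only
        when \<open>y\<close> has degree \<open>3\<close>.\<close>
      have "card (nbrs G y) = 3"
      proof (rule ccontr)
        assume "card (nbrs G y) \<noteq> 3"
        then have c: "4 \<le> card (nbrs G y)" using deg[OF yV(1) y(2)] by simp
        show False
        proof (rule IH[OF G2(1,2), of y z])
          show "3 \<le> card (nbrs ?G2 v)" if "v \<in> pverts ?G2" "v \<noteq> z" for v
            using that c c2y N2[of v] deg[of v] V2 by (cases "v = y") auto
        qed (use V2 z y yV smaller[of ?G2 x] xV x wV in auto)
      qed
      then obtain t where t: "nbrs G y = {x, w, t}" "t \<noteq> x" "t \<noteq> w"
        using card3_third[of "nbrs G y" x w] xV wy yV by metis
      have tV: "t \<in> pverts G" "t \<noteq> y" "t \<noteq> z" "t \<in> nbrs G y"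
        using t nbrs_subset[OF G] irr zy by blast+
      \<comment> \<open>If \<open>t\<close> were adjacent to \<open>z\<close>, contracting
        \<open>yt\<close> would supply the missing edge \<open>zy\<close> and complete a
        \<open>K\<^sub>4\<close> on \<open>z\<close>, \<open>w\<close>, \<open>x\<close>,
        \<open>y\<close>.\<close>
      have tz: "t \<notin> nbrs G z"
      proof
        assume tz: "t \<in> nbrs G z"
        let ?H = "contract_edge G y t"
        note H = pair_graph_contract[OF G tV(4)] K4_minor_free_contract[OF G tV(4) K]
        note nH = nbrs_contract_other[OF G tV(4)]
        have "t \<notin> nbrs G x" "t \<notin> nbrs G w" using y Nw t tV by auto
        then have "nbrs ?H x = {z, w, y}" "nbrs ?H w = {z, x, y}"
          using nH[of x] nH[of w] y Nw t yV by auto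
        moreover have "y \<in> nbrs ?H z" "x \<in> nbrs ?H z" "w \<in> nbrs ?H z"
          using nH[of z] tz y tV x w t by auto
        ultimately show False
          using clique4[OF H, of x z w y] by blast
      qed
      have N2yt: "nbrs ?G2 y = {z, t}" using N2y t by auto
      have y2: "y \<in> nbrs ?G2 z" unfolding nbrs_sym[OF G2(1), of y] using N2yt by simp
      \<comment> \<open>As \<open>t\<close> is the only neighbour of \<open>y\<close> left besides
        \<open>z\<close>, and \<open>t\<close> is not adjacent to \<open>z\<close>, absorbing
        \<open>y\<close> as well lowers no degree outside the root.\<close>
      let ?G3 = "contract_edge ?G2 z y"
      note G3 = pair_graph_contract[OF G2(1) y2] K4_minor_free_contract[OF G2(1) y2 G2(2)] pverts_contract[OF G2(1) y2]
      have V3: "pverts ?G3 = pverts G - {x, w, y}" using G3(3) V2 by auto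
      show False
      proof (rule IH[OF G3(1,2), of t z])
        show "3 \<le> card (nbrs ?G3 v)" if v: "v \<in> pverts ?G3" "v \<noteq> z" for v
        proof -
          have v': "v \<notin> {x, z, w, y}" "v \<in> pverts G" using v V3 by auto
          have "\<not> (z \<in> nbrs ?G2 v \<and> y \<in> nbrs ?G2 v)"
            using N2[OF v'(1)] sym[of v y] sym[of v z] t tz v' by auto
          then show ?thesis
            using card_nbrs_contract[OF G2(1) y2, of v] v' N2[OF v'(1)] deg[of v] by auto
        qed
      qed (use V3 z y yV smaller[of ?G3 x] xV x wV tV t in auto)
    qed
  qed
qed

text \<open>If none of the four configurations occurs, Dirac's theorem leaves a vertex
  \<open>u\<close> of degree \<open>2\<close>. Suppressing it keeps all other degrees, so by
  induction the smaller graph has a configuration, which is traced back to one in \<open>G\<close>.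
  Excluding twins stops the new edge \<open>ab\<close> from closing a triangle at another vertex of
  degree \<open>2\<close>.\<close>

lemma exists_reducible_configuration:
  assumes "pair_graph G" "K4_minor_free G" "pverts G \<noteq> {}"
  shows "(\<exists>v \<in> pverts G. card (nbrs G v) \<le> 1)
    \<or> (\<exists>u v. v \<in> nbrs G u \<and> card (nbrs G u) = 2 \<and> card (nbrs G v) = 2)
    \<or> (\<exists>u v. u \<noteq> v \<and> card (nbrs G u) = 2 \<and> nbrs G u = nbrs G v)
    \<or> (\<exists>u a b. nbrs G u = {a, b} \<and> b \<in> nbrs G a)"
  using assms
proof (induction "card (pverts G)" arbitrary: G rule: less_induct)
  case less
  note G = less.prems(1)
  note sym = nbrs_sym[OF G] and irr = nbrs_irrefl[OF G]
  have S: "v \<in> nbrs G u" if "u \<in> nbrs G v" for u v using that sym by blast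
  show ?case
  proof (rule ccontr)
    assume "\<not> ?case"
    then have deg': "\<And>v. v \<in> pverts G \<Longrightarrow> \<not> card (nbrs G v) \<le> 1"
      and adj: "\<And>u v. v \<in> nbrs G u \<Longrightarrow> card (nbrs G u) = 2 \<Longrightarrow> card (nbrs G v) \<noteq> 2"
      and twin: "\<And>u v. u \<noteq> v \<Longrightarrow> card (nbrs G u) = 2 \<Longrightarrow> nbrs G u \<noteq> nbrs G v"
      and tri: "\<And>u a b. nbrs G u = {a, b} \<Longrightarrow> b \<notin> nbrs G a"
      by (blast, blast, blast, blast)
    have deg: "2 \<le> card (nbrs G v)" if "v \<in> pverts G" for v
      using deg'[OF that] by simp
    obtain z where z: "z \<in> pverts G" using less.prems by blast
    have "pverts G \<noteq> {z}"
      using deg[OF z] nbrs_subset[OF G, of z] irr[of z]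
      by (metis card.empty not_numeral_le_zero subset_singletonD insertI1)
    then obtain u where u: "u \<in> pverts G" "card (nbrs G u) = 2"
      using not_K4_minor_free_rooted[OF G z] deg less.prems(2)
      by (metis One_nat_def Suc_1 le_antisym not_less_eq_eq numeral_3_eq_3)
    then obtain a b where ab: "nbrs G u = {a, b}" "a \<noteq> b" by (auto simp: card_2_iff)
    have ne: "u \<noteq> a" "u \<noteq> b" "u \<in> nbrs G a" "u \<in> nbrs G b" using ab irr S by blast+
    have nab: "b \<notin> nbrs G a" "a \<notin> nbrs G b" using tri[OF ab(1)] S by blast+
    \<comment> \<open>No two vertices of degree \<open>2\<close> are adjacent, so \<open>a\<close>
      and \<open>b\<close> have degree at least \<open>3\<close>; hence every vertex of degree
      \<open>2\<close> in \<open>?H\<close> has the same neighbours as in \<open>G\<close>.\<close>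
    have dab: "card (nbrs G a) \<noteq> 2" "card (nbrs G b) \<noteq> 2"
      using adj[of a u] adj[of b u] ab u by auto
    let ?H = "contract_edge G a u"
    note H = pair_graph_contract[OF G ne(3)] K4_minor_free_contract[OF G ne(3) less.prems(2)]
      pverts_contract[OF G ne(3)]
    have Na: "nbrs ?H a = insert b (nbrs G a - {u})"
      using nbrs_contract_merged[OF G ne(3)] ab ne irr[of a] by auto
    have Nb: "nbrs ?H b = insert a (nbrs G b - {u})"
      using nbrs_contract_other[OF G ne(3), of b] ab ne by auto
    have N: "nbrs ?H v = nbrs G v" if "v \<notin> {a, b, u}" for v
      using nbrs_contract_other[OF G ne(3), of v] that ab sym[of v u] by auto
    have c: "card (nbrs ?H v) = card (nbrs G v)" if "v \<noteq> u" for v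
      using N[of v] that Na Nb card_insert_remove_swap[OF ne(3) nab(1) finite_nbrs[OF G]]
        card_insert_remove_swap[OF ne(4) nab(2) finite_nbrs[OF G]]
      by (metis empty_iff insert_iff)
    have N2: "nbrs ?H v = nbrs G v \<and> v \<notin> {a, b, u}" if "card (nbrs ?H v) = 2" for v
    proof -
      have "v \<noteq> u"
        using that nbrs_subset[OF H(1)] nbrs_vertex[OF H(1)] H(3)
        by (metis Diff_iff card.empty ex_in_conv insertI1 zero_neq_numeral)
      then have "v \<notin> {a, b, u}" using that c[of v] dab by auto
      then show ?thesis using N by blast
    qed
    have "pverts ?H \<noteq> {}" "card (pverts ?H) < card (pverts G)"
      using H(3) ab ne u nbrs_subset[OF G, of u] card_pverts_less[OF G u(1), of ?H] by auto
    with less.hyps[OF this(2) H(1,2)]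
    consider (1) v where "v \<in> pverts ?H" "card (nbrs ?H v) \<le> 1"
      | (2) p q where "q \<in> nbrs ?H p" "card (nbrs ?H p) = 2" "card (nbrs ?H q) = 2"
      | (3) p q where "p \<noteq> q" "card (nbrs ?H p) = 2" "nbrs ?H p = nbrs ?H q"
      | (4) p d e where "nbrs ?H p = {d, e}" "e \<in> nbrs ?H d"
      by blast
    then show False
    proof cases
      case 1
      then show False using deg[of v] c[of v] H(3) by auto
    next
      case 2
      then show False using adj N2 by metis
    next
      case 3
      then show False using twin N2 by metis
    next
      \<comment> \<open>The only edge of \<open>?H\<close> absent from \<open>G\<close> is
        \<open>ab\<close>. A new triangle at \<open>p\<close> would force
        \<open>{d, e} = {a, b}\<close>, making \<open>p\<close> a twin of \<open>u\<close>.\<close>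
      case 4
      then have de: "d \<noteq> e" using nbrs_irrefl[OF H(1)] by blast
      then have p: "nbrs G p = {d, e}" "p \<notin> {a, b, u}" using N2[of p] 4 by auto
      have "u \<noteq> d" "u \<noteq> e" using ab(1) p S by blast+
      moreover have "{d, e} \<noteq> {a, b}" using twin[of p u] p ab de by auto
      moreover have "e \<notin> nbrs G d" using tri[OF p(1)] .
      ultimately show False
        using 4(2) Na Nb N[of d] by (cases "d = a"; cases "d = b") auto
    qed
  qed
qed

section \<open>A subspace on which the adjacency form is bounded\<close>

text \<open>The quadratic form \<open>x\<^sup>T A x\<close>; a sum over arcs counts every edge
  twice.\<close>

definition adj_form :: "'a pair_pre_digraph \<Rightarrow> ('a \<Rightarrow> real) \<Rightarrow> real" where
  "adj_form G x = (\<Sum>(u, v) \<in> parcs G. x u * x v)"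

text \<open>
  The subspace is given by the functionals that vanish on it, so codimension at most \<open>k\<close> needs no linear
  independence.
\<close>

definition form_bounded_codim :: "real \<Rightarrow> 'a pair_pre_digraph \<Rightarrow> nat \<Rightarrow> bool" where
  "form_bounded_codim s G k \<longleftrightarrow> (\<exists>L :: ('a \<Rightarrow> real) set. finite L \<and> card L \<le> k \<and>
     (\<forall>x. (\<forall>l \<in> L. (\<Sum>v \<in> pverts G. l v * x v) = 0)
        \<longrightarrow> s * adj_form G x \<le> (\<Sum>v \<in> pverts G. (x v)\<^sup>2)))"

lemma adj_form_eq_sum_nbrs:
  assumes "pair_graph G"
  shows "adj_form G x = (\<Sum>u \<in> pverts G. \<Sum>v \<in> nbrs G u. x u * x v)"
proof -
  have "parcs G = Sigma (pverts G) (nbrs G)"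
    using assms unfolding pair_graph_iff by (auto simp: nbrs_def)
  then show ?thesis
    using assms finite_nbrs[OF assms] unfolding pair_graph_iff adj_form_def by (simp add: sum.Sigma)
qed

lemma form_bounded_codim_empty: "pair_graph G \<Longrightarrow> pverts G = {} \<Longrightarrow> form_bounded_codim s G 0"
  unfolding form_bounded_codim_def by (rule exI[of _ "{}"]) (simp add: adj_form_eq_sum_nbrs)

text \<open>For \<open>s = 1\<close> or \<open>s = -1\<close>, \<open>s * (x u * x v)\<close> is at
  most the mean of the two squares. Summed over the symmetric set \<open>E\<close>, each square
  \<open>(x u)\<^sup>2\<close> acquires the degree of \<open>u\<close> as coefficient, which is at
  most \<open>1\<close>.\<close>

lemma sum_arcs_max_degree_1_le:
  fixes x :: "'a \<Rightarrow> real"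
  assumes E: "finite D" "E \<subseteq> D \<times> D" "sym E" and deg: "\<And>u. u \<in> D \<Longrightarrow> card {v. (u, v) \<in> E} \<le> 1"
    and s: "\<bar>s\<bar> = 1"
  shows "s * (\<Sum>(u, v) \<in> E. x u * x v) \<le> (\<Sum>u \<in> D. (x u)\<^sup>2)"
proof -
  have fE: "finite E" using E finite_subset by blast
  have sq: "(\<Sum>(u, v) \<in> E. (x v)\<^sup>2) = (\<Sum>(u, v) \<in> E. (x u)\<^sup>2)"
    by (rule sum.reindex_bij_witness[of _ prod.swap prod.swap]) (use \<open>sym E\<close> in \<open>auto dest: symD\<close>)
  have "s * (\<Sum>(u, v) \<in> E. x u * x v) = (\<Sum>(u, v) \<in> E. s * (x u * x v))"
    by (simp add: sum_distrib_left case_prod_unfold)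
  also have "\<dots> \<le> (\<Sum>(u, v) \<in> E. ((x u)\<^sup>2 + (x v)\<^sup>2) / 2)"
  proof (rule sum_mono, clarify)
    fix u v
    have "s = 1 \<or> s = -1" using s by linarith
    moreover have "0 \<le> (x u - x v)\<^sup>2" "0 \<le> (x u + x v)\<^sup>2" by simp_all
    ultimately show "s * (x u * x v) \<le> ((x u)\<^sup>2 + (x v)\<^sup>2) / 2"
      by (auto simp: power2_eq_square algebra_simps)
  qed
  also have "\<dots> = ((\<Sum>(u, v) \<in> E. (x u)\<^sup>2) + (\<Sum>(u, v) \<in> E. (x v)\<^sup>2)) / 2"
    by (simp add: sum.distrib case_prod_unfold sum_divide_distrib[symmetric])
  also have "\<dots> = (\<Sum>(u, v) \<in> E. (x u)\<^sup>2)" unfolding sq by simp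
  also have "\<dots> = (\<Sum>u \<in> D. \<Sum>v \<in> {v. (u, v) \<in> E}. (x u)\<^sup>2)"
  proof -
    have eq: "Sigma D (\<lambda>u. {v. (u, v) \<in> E}) = E" using E by auto
    have "\<forall>u \<in> D. finite {v. (u, v) \<in> E}"
    proof
      fix u
      have "{v. (u, v) \<in> E} \<subseteq> D" using E(2) by blast
      then show "finite {v. (u, v) \<in> E}" using E(1) by (rule finite_subset)
    qed
    from sum.Sigma[OF E(1) this, of "\<lambda>u v. (x u)\<^sup>2"] show ?thesis
      unfolding eq by (rule sym)
  qed
  also have "\<dots> \<le> (\<Sum>u \<in> D. (x u)\<^sup>2)"
  proof (rule sum_mono)
    fix u assume "u \<in> D"
    then have "real (card {v. (u, v) \<in> E}) * (x u)\<^sup>2 \<le> 1 * (x u)\<^sup>2"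
      by (intro mult_right_mono) (use deg[of u] in auto)
    then show "(\<Sum>v \<in> {v. (u, v) \<in> E}. (x u)\<^sup>2) \<le> (x u)\<^sup>2" by simp
  qed
  finally show ?thesis .
qed

text \<open>When \<open>x\<close> vanishes on \<open>N\<close>, only arcs inside \<open>D\<close>
  and arcs of the remaining graph contribute, and the two parts are bounded separately. The price is
  one coordinate functional for each vertex of \<open>N\<close>.\<close>

lemma form_bounded_codim_extend:
  assumes G: "pair_graph G" and DN: "D \<subseteq> pverts G" "N \<subseteq> pverts G" "D \<inter> N = {}"
    and nb: "\<And>u. u \<in> D \<Longrightarrow> nbrs G u \<subseteq> D \<union> N"
    and deg: "\<And>u. u \<in> D \<Longrightarrow> card (nbrs G u \<inter> D) \<le> 1"
    and s: "\<bar>s\<bar> = 1"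
    and IH: "form_bounded_codim s (delete_vertices G (D \<union> N)) k"
  shows "form_bounded_codim s G (k + card N)"
proof -
  let ?H = "delete_vertices G (D \<union> N)" and ?V = "pverts G"
  have fV: "finite ?V" "parcs G \<subseteq> ?V \<times> ?V" "sym (parcs G)" using G pair_graph_iff by metis+
  have fin: "finite D" "finite N" using DN fV finite_subset by blast+
  have fE: "finite (parcs G)" using fV finite_subset by blast
  obtain L :: "('a \<Rightarrow> real) set" where L: "finite L" "card L \<le> k"
    "\<forall>x. (\<forall>l \<in> L. (\<Sum>v \<in> pverts ?H. l v * x v) = 0)
      \<longrightarrow> s * adj_form ?H x \<le> (\<Sum>v \<in> pverts ?H. (x v)\<^sup>2)"
    using IH unfolding form_bounded_codim_def by (elim exE conjE)
  define ext :: "('a \<Rightarrow> real) \<Rightarrow> 'a \<Rightarrow> real" where "ext l v = (if v \<in> pverts ?H then l v else 0)" for l v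
  define coord :: "'a \<Rightarrow> 'a \<Rightarrow> real" where "coord u v = (if v = u then 1 else 0)" for u v
  define L' where "L' = ext ` L \<union> coord ` N"
  have "card L' \<le> card (ext ` L) + card (coord ` N)"
    unfolding L'_def by (rule card_Un_le)
  also have "\<dots> \<le> k + card N"
    using add_mono[OF card_image_le[OF L(1)] card_image_le[OF fin(2)], of ext coord] L(2) by linarith
  finally have "card L' \<le> k + card N" .
  moreover have "finite L'" using L fin by (simp add: L'_def)
  moreover have "s * adj_form G x \<le> (\<Sum>v \<in> ?V. (x v)\<^sup>2)"
    if x: "\<forall>l \<in> L'. (\<Sum>v \<in> ?V. l v * x v) = 0" for x
  proof -
    have xN: "x u = 0" if "u \<in> N" for u
    proof -
      have "(\<Sum>v \<in> ?V. coord u v * x v) = 0" using x that by (simp add: L'_def)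
      moreover have "(\<Sum>v \<in> ?V. coord u v * x v) = (\<Sum>v \<in> ?V. if v = u then x v else 0)"
        by (rule sum.cong) (auto simp: coord_def)
      ultimately show ?thesis using that DN fV by (auto simp: sum.delta)
    qed
    have H: "s * adj_form ?H x \<le> (\<Sum>v \<in> pverts ?H. (x v)\<^sup>2)"
    proof (rule L(3)[rule_format])
      fix l assume "l \<in> L"
      then have "(\<Sum>v \<in> ?V. ext l v * x v) = 0" using x by (simp add: L'_def)
      moreover have "(\<Sum>v \<in> pverts ?H. l v * x v) = (\<Sum>v \<in> ?V. ext l v * x v)"
        by (rule sum.mono_neutral_cong_left) (use fV in \<open>auto simp: ext_def\<close>)
      ultimately show "(\<Sum>v \<in> pverts ?H. l v * x v) = 0" by simp
    qed
    define E where "E = parcs G \<inter> D \<times> D"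
    have ED: "s * (\<Sum>(u, v) \<in> E. x u * x v) \<le> (\<Sum>u \<in> D. (x u)\<^sup>2)"
    proof (rule sum_arcs_max_degree_1_le)
      show "sym E" using fV(3) by (auto simp: E_def sym_def)
      fix u assume "u \<in> D"
      then have "{v. (u, v) \<in> E} = nbrs G u \<inter> D" by (auto simp: E_def nbrs_def)
      then show "card {v. (u, v) \<in> E} \<le> 1" using deg \<open>u \<in> D\<close> by simp
    qed (use fin s in \<open>auto simp: E_def\<close>)
    have split: "adj_form G x = adj_form ?H x + (\<Sum>(u, v) \<in> E. x u * x v)"
    proof -
      have sub: "parcs ?H \<union> E \<subseteq> parcs G" by (auto simp: E_def delete_vertices_def)
      have zero: "x u * x v = 0" if a: "(u, v) \<in> parcs G" "(u, v) \<notin> parcs ?H \<union> E" for u v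
      proof -
        have "(v, u) \<in> parcs G" using a fV by (auto dest: symD)
        then have "u \<in> D \<Longrightarrow> v \<in> D \<union> N" "v \<in> D \<Longrightarrow> u \<in> D \<union> N"
          using a nb[of u] nb[of v] by (auto simp: nbrs_def)
        then have "u \<in> N \<or> v \<in> N" using a by (auto simp: E_def delete_vertices_def)
        then show ?thesis using xN by auto
      qed
      have "adj_form G x = (\<Sum>(u, v) \<in> parcs ?H \<union> E. x u * x v)"
        unfolding adj_form_def
      proof (rule sum.mono_neutral_right[OF fE sub], rule ballI)
        fix p assume "p \<in> parcs G - (parcs ?H \<union> E)"
        then have "x (fst p) * x (snd p) = 0" by (intro zero) simp_all
        then show "(case p of (u, v) \<Rightarrow> x u * x v) = 0" by (simp add: case_prod_unfold)
      qed
      also have "\<dots> = adj_form ?H x + (\<Sum>(u, v) \<in> E. x u * x v)"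
        unfolding adj_form_def
        by (rule sum.union_disjoint) (use fE in \<open>auto simp: E_def delete_vertices_def intro: finite_subset[OF _ fE]\<close>)
      finally show ?thesis .
    qed
    have "(\<Sum>v \<in> pverts ?H. (x v)\<^sup>2) + (\<Sum>u \<in> D. (x u)\<^sup>2) = (\<Sum>v \<in> pverts ?H \<union> D. (x v)\<^sup>2)"
      by (rule sum.union_disjoint[symmetric]) (use fV fin in auto)
    also have "\<dots> \<le> (\<Sum>v \<in> ?V. (x v)\<^sup>2)"
      by (rule sum_mono2) (use fV DN in auto)
    finally show ?thesis using H ED by (simp add: split distrib_left)
  qed
  ultimately show ?thesis unfolding form_bounded_codim_def by (intro exI[of _ L'] conjI allI impI) blast+
qed

text \<open>Covers the exception with two vertices in each of \<open>D\<close> and \<open>N\<close>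
  and none left, where vanishing on \<open>N\<close> would cost half the dimension. The cycle
  contributes \<open>2 * (x u + x v) * (x a + x b)\<close> to the form, and one linear condition
  makes \<open>s\<close> times this nonpositive; a chord \<open>ab\<close> adds at most
  \<open>(x a)\<^sup>2 + (x b)\<^sup>2\<close>.\<close>

lemma form_bounded_codim_four_cycle:
  assumes G: "pair_graph G" and V: "pverts G = {u, v, a, b}" "distinct [u, v, a, b]"
    and N: "nbrs G u = {a, b}" "nbrs G v = {a, b}"
    and s: "\<bar>s\<bar> = 1"
  shows "form_bounded_codim s G 1"
proof -
  \<comment> \<open>The weights make the condition read
    \<open>x u + x v = - s * (x a + x b)\<close>, so that \<open>s * s = 1\<close> settles both
    signs at once.\<close>
  define l :: "'a \<Rightarrow> real" where "l w = (if w \<in> {u, v} then 1 else s)" for w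
  have sums: "(\<Sum>w \<in> pverts G. f w) = f u + f v + f a + f b" for f :: "'a \<Rightarrow> real"
    using V by simp
  have s2: "s * s = 1" using s by (metis abs_mult_self_eq mult_1)
  have ua: "u \<in> nbrs G a" "v \<in> nbrs G a" "u \<in> nbrs G b" "v \<in> nbrs G b"
    using N nbrs_sym[OF G] by blast+
  have "s * adj_form G x \<le> (\<Sum>w \<in> pverts G. (x w)\<^sup>2)" if "(\<Sum>w \<in> pverts G. l w * x w) = 0" for x
  proof -
    have sub: "nbrs G a \<subseteq> {u, v, b}" "nbrs G b \<subseteq> {u, v, a}"
      using nbrs_subset[OF G] nbrs_irrefl[OF G] V by blast+
    define e :: real where "e = (if b \<in> nbrs G a then 1 else 0)"
    have "nbrs G a = (if b \<in> nbrs G a then {u, v, b} else {u, v})"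
      "nbrs G b = (if b \<in> nbrs G a then {u, v, a} else {u, v})"
      using sub ua nbrs_sym[OF G, of b a] by auto
    then have na: "(\<Sum>w \<in> nbrs G a. x a * x w) = x a * (x u + x v + e * x b)"
      and nb: "(\<Sum>w \<in> nbrs G b. x b * x w) = x b * (x u + x v + e * x a)"
      using V(2) by (auto simp: e_def algebra_simps split: if_splits)
    have "adj_form G x = (\<Sum>w \<in> {a, b}. x u * x w) + (\<Sum>w \<in> {a, b}. x v * x w)
        + x a * (x u + x v + e * x b) + x b * (x u + x v + e * x a)"
      by (simp only: adj_form_eq_sum_nbrs[OF G] sums na nb N)
    then have form: "adj_form G x = 2 * (x u + x v) * (x a + x b) + 2 * e * (x a * x b)"
      using V(2) by (simp add: algebra_simps)
    have "x u + x v = - s * (x a + x b)"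
    proof -
      have "l u = 1" "l v = 1" "l a = s" "l b = s" using V(2) by (auto simp: l_def)
      then show ?thesis using that by (simp add: sums algebra_simps)
    qed
    then have "adj_form G x = 2 * (- s * (x a + x b)) * (x a + x b) + 2 * e * (x a * x b)"
      unfolding form by (rule arg_cong)
    then have "s * adj_form G x = s * (2 * (- s * (x a + x b)) * (x a + x b) + 2 * e * (x a * x b))"
      by (simp only:)
    also have "\<dots> = - 2 * (s * s) * (x a + x b)\<^sup>2 + 2 * (s * e) * (x a * x b)"
      by (simp add: power2_eq_square algebra_simps)
    also have "\<dots> \<le> 2 * (s * e) * (x a * x b)" unfolding s2 by simp
    also have "\<dots> \<le> (x a)\<^sup>2 + (x b)\<^sup>2"
    proof -
      have "0 \<le> (x a - x b)\<^sup>2" "0 \<le> (x a + x b)\<^sup>2" "0 \<le> (x a)\<^sup>2 + (x b)\<^sup>2" by simp_all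
      moreover have "s = 1 \<or> s = -1" using s by linarith
      ultimately show ?thesis unfolding e_def by (auto simp: power2_eq_square algebra_simps)
    qed
    also have "\<dots> \<le> (\<Sum>w \<in> pverts G. (x w)\<^sup>2)" by (simp add: sums)
    finally show ?thesis .
  qed
  then show ?thesis unfolding form_bounded_codim_def by (intro exI[of _ "{l}"]) auto
qed

text \<open>A reduction pays codimension \<open>card N\<close> for removing
  \<open>card D + card N\<close> vertices, so \<open>card N <= card D\<close> preserves the bound on
  \<open>2 * k\<close>. Strictness is inherited from a nonempty remainder or comes from
  \<open>card N < card D\<close>.\<close>

lemma subcubic_form_bounded:
  assumes "pair_graph G" "pverts G \<noteq> {}" "K4_minor_free G"
    and "\<And>v. v \<in> pverts G \<Longrightarrow> card (nbrs G v) \<le> 3" and "\<bar>s\<bar> = 1"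
  shows "\<exists>k. form_bounded_codim s G k \<and> 2 * k < card (pverts G)"
  using assms
proof (induction "card (pverts G)" arbitrary: G rule: less_induct)
  case less
  note G = less.prems(1) and cubic = less.prems(4)
  note irr = nbrs_irrefl[OF G] and sub = nbrs_subset[OF G]
  have S: "v \<in> nbrs G u" if "u \<in> nbrs G v" for u v using that nbrs_sym[OF G] by blast
  have fV: "finite (pverts G)" using G pair_graph_iff by metis
  have reduce: ?case
    if D: "D \<subseteq> pverts G" "N \<subseteq> pverts G" "D \<inter> N = {}" "D \<noteq> {}"
      "\<And>u. u \<in> D \<Longrightarrow> nbrs G u \<subseteq> D \<union> N" "\<And>u. u \<in> D \<Longrightarrow> card (nbrs G u \<inter> D) \<le> 1"
      and c: "card N < card D \<or> card N \<le> card D \<and> pverts G \<noteq> D \<union> N" for D N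
  proof -
    let ?H = "delete_vertices G (D \<union> N)"
    have fin: "finite D" "finite N" using D fV finite_subset by blast+
    have H: "pair_graph ?H" by (rule pair_graph_delete_vertices[OF G])
    have card: "card (pverts G) = card (pverts ?H) + card D + card N"
    proof -
      have "card (D \<union> N) = card D + card N" using fin D by (simp add: card_Un_disjoint)
      moreover have "card (D \<union> N) \<le> card (pverts G)" using D fV by (intro card_mono) auto
      ultimately show ?thesis using fin D by (simp add: card_Diff_subset)
    qed
    have pos: "card D > 0" using fin D by (simp add: card_gt_0_iff)
    show ?case
    proof (cases "pverts ?H = {}")
      case True
      then have "card N < card D" using c D by auto
      moreover have "form_bounded_codim s G (0 + card N)"
        using form_bounded_codim_extend[OF G D(1-3,5,6) less.prems(5) form_bounded_codim_empty[OF H True]] .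
      ultimately show ?thesis using card by (intro exI[of _ "card N"]) auto
    next
      case False
      have "K4_minor_free ?H"
        by (rule K4_minor_free_delete_vertices[OF less.prems(3)]) (use fin D in auto)
      moreover have "card (nbrs ?H v) \<le> 3" if "v \<in> pverts ?H" for v
        using that cubic[of v] finite_nbrs[OF G] card_mono[of "nbrs G v" "nbrs G v - (D \<union> N)"]
        by (simp add: nbrs_delete_vertices)
      ultimately obtain k where k: "form_bounded_codim s ?H k" "2 * k < card (pverts ?H)"
        using less.hyps[of ?H] H False less.prems(5) card pos by auto
      have "form_bounded_codim s G (k + card N)"
        using form_bounded_codim_extend[OF G D(1-3,5,6) less.prems(5) k(1)] .
      then show ?thesis using k(2) card c by (intro exI[of _ "k + card N"]) auto
    qed
  qed
  \<comment> \<open>Without loops, two vertices have inner degree at most \<open>1\<close>. The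
    reduction fails only if \<open>N\<close> has two elements and \<open>{p, q}\<close> and
    \<open>N\<close> exhaust the graph.\<close>
  have reduce_pair: ?case
    if p: "p \<in> pverts G" "q \<in> pverts G" "N \<subseteq> pverts G" "p \<noteq> q" "p \<notin> N" "q \<notin> N"
      "nbrs G p \<subseteq> insert q N" "nbrs G q \<subseteq> insert p N" "card N \<le> 2"
      and c: "card N < 2 \<or> pverts G \<noteq> {p, q} \<union> N" for p q N
  proof (rule reduce[of "{p, q}" N])
    show "card (nbrs G u \<inter> {p, q}) \<le> 1" if "u \<in> {p, q}" for u
    proof -
      have "nbrs G u \<inter> {p, q} \<subseteq> {if u = p then q else p}" using that irr[of u] by auto
      from card_mono[OF _ this] show ?thesis by simp
    qed
    show "nbrs G u \<subseteq> {p, q} \<union> N" if "u \<in> {p, q}" for u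
      using that p(7,8) by blast
    show "card N < card {p, q} \<or> card N \<le> card {p, q} \<and> pverts G \<noteq> {p, q} \<union> N"
    proof -
      have "card {p, q} = 2" using p(4) by simp
      then show ?thesis using c p(9) by simp
    qed
  qed (use p in auto)
  have two: "card {x, y} \<le> 2" for x y :: 'a by (simp add: card_insert_if)
  have cycle: ?case if "pverts G = {u, v, a, b}" "distinct [u, v, a, b]"
    "nbrs G u = {a, b}" "nbrs G v = {a, b}" for u v a b
    using form_bounded_codim_four_cycle[OF G that less.prems(5)] that(1,2)
    by (intro exI[of _ 1]) simp
  show ?case
  proof (cases "\<exists>v \<in> pverts G. card (nbrs G v) \<le> 1")
    case True
    then obtain v where v: "v \<in> pverts G" "card (nbrs G v) \<le> 1" by blast
    show ?thesis
    proof (cases "nbrs G v = {}")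
      case True
      show ?thesis
        by (rule reduce[of "{v}" "{}"]) (use v True in auto)
    next
      case False
      then have "card (nbrs G v) = 1" using v finite_nbrs[OF G] by (simp add: le_Suc_eq)
      then obtain u where u: "nbrs G v = {u}" by (auto simp: card_1_singleton_iff)
      then have uv: "u \<in> pverts G" "u \<noteq> v" "v \<in> nbrs G u" using sub irr S by blast+
      show ?thesis
      proof (cases "pverts G = {v, u}")
        case True
        then have "nbrs G u = {v}" using sub[of u] irr[of u] uv by blast
        then show ?thesis
          by (intro reduce[of "{u, v}" "{}"]) (use u uv v in auto)
      next
        case False
        then show ?thesis
          by (intro reduce[of "{v}" "{u}"]) (use u uv v in auto)
      qed
    qed
  next
    case False
    then have deg: "2 \<le> card (nbrs G v)" if "v \<in> pverts G" for v using that by force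
    consider (adj) u v where "v \<in> nbrs G u" "card (nbrs G u) = 2" "card (nbrs G v) = 2"
      | (twin) u v where "u \<noteq> v" "card (nbrs G u) = 2" "nbrs G u = nbrs G v"
      | (tri) u a b where "nbrs G u = {a, b}" "b \<in> nbrs G a"
      using exists_reducible_configuration[OF G less.prems(3,2)] False by blast
    then show ?thesis
    proof cases
      case adj
      obtain a where a: "nbrs G u = {v, a}" "a \<noteq> v" using card2_second[OF adj(2,1)] by metis
      obtain b where b: "nbrs G v = {u, b}" "b \<noteq> u" using card2_second[OF adj(3) S[OF adj(1)]] by metis
      have ne: "u \<noteq> v" "a \<noteq> u" "b \<noteq> v" "u \<in> nbrs G a" "v \<in> nbrs G b" using a b irr S by blast+
      have V: "u \<in> pverts G" "v \<in> pverts G" "a \<in> pverts G" "b \<in> pverts G" using a b sub by blast+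
      show ?thesis
      proof (cases "pverts G = {u, v, a, b} \<and> a \<noteq> b")
        case True
        \<comment> \<open>If nothing else is left, minimum degree \<open>2\<close> forces the edge
          \<open>ab\<close>. The graph is then the cycle \<open>u, v, b, a\<close>, in which
          \<open>v\<close> and \<open>a\<close> have the same neighbours.\<close>
        have "v \<notin> nbrs G a" using b True a S ne by blast
        then have "nbrs G a \<subseteq> {u, b}" using sub[of a] irr[of a] True by blast
        then have "nbrs G a = {u, b}"
          using deg[OF V(3)] card_seteq[of "{u, b}" "nbrs G a"] b by simp
        then show ?thesis
          using cycle[of v a u b] b True ne a by auto
      next
        case False
        show ?thesis
        proof (rule reduce_pair[of u v "{a, b}"])
          show "card {a, b} < 2 \<or> pverts G \<noteq> {u, v} \<union> {a, b}" using False by (cases "a = b") auto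
        qed (use V a b ne two in simp_all)
      qed
    next
      case twin
      then obtain a b where ab: "nbrs G u = {a, b}" "a \<noteq> b" by (auto simp: card_2_iff)
      then have ab': "nbrs G v = {a, b}" using twin by simp
      have ne: "u \<noteq> a" "u \<noteq> b" "v \<noteq> a" "v \<noteq> b" "u \<in> nbrs G a" "v \<in> nbrs G a" using ab ab' irr S by blast+
      have V: "u \<in> pverts G" "v \<in> pverts G" "a \<in> pverts G" "b \<in> pverts G" using ab ne sub by blast+
      show ?thesis
      proof (cases "pverts G = {u, v, a, b}")
        case True
        then show ?thesis using cycle[of u v a b] ab ab' ne twin(1) by auto
      next
        case False
        show ?thesis
        proof (rule reduce_pair[of u v "{a, b}"])
          show "card {a, b} < 2 \<or> pverts G \<noteq> {u, v} \<union> {a, b}" using False by auto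
        qed (use V ab ab' ne two twin(1) in \<open>simp_all add: subset_insertI\<close>)
      qed
    next
      case tri
      have ne: "a \<noteq> b" "u \<noteq> a" "u \<noteq> b" "u \<in> nbrs G a" "u \<in> nbrs G b" "a \<in> nbrs G b"
        using tri irr S by blast+
      have V: "u \<in> pverts G" "a \<in> pverts G" "b \<in> pverts G" using tri ne sub by blast+
      \<comment> \<open>Here the bound \<open>3\<close> on degrees matters: besides \<open>u\<close>
        and \<open>b\<close>, the vertex \<open>a\<close> has at most one neighbour
        \<open>c\<close>, so \<open>{u, a}\<close> has no outer neighbours other than
        \<open>b\<close> and \<open>c\<close>.\<close>
      have "card {u, b} \<le> card (nbrs G a)"
        by (rule card_mono) (use ne tri finite_nbrs[OF G] in auto)
      then consider "nbrs G a = {u, b}" | "card (nbrs G a) = 3"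
        using cubic[OF V(2)] card_seteq[of "nbrs G a" "{u, b}"] finite_nbrs[OF G] ne tri
        by (fastforce simp: le_Suc_eq)
      then show ?thesis
      proof cases
        case 1
        show ?thesis
          by (rule reduce_pair[of u a "{b}"]) (use V tri(1) 1 ne(1-3) in simp_all)
      next
        case 2
        obtain c where c: "nbrs G a = {u, b, c}" "c \<noteq> u" "c \<noteq> b"
          using card3_third[OF 2 ne(4) tri(2) ne(3)] by metis
        have cV: "c \<in> pverts G" "c \<noteq> a" "a \<in> nbrs G c" using c sub irr S by blast+
        have uc: "u \<notin> nbrs G c" using tri c cV S by blast
        show ?thesis
        proof (cases "pverts G = {u, a, b, c}")
          case True
          \<comment> \<open>With four vertices in total, minimum degree \<open>2\<close> makes
            \<open>c\<close> a twin of \<open>u\<close>, and \<open>ab\<close> is a chord of the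
            resulting cycle.\<close>
          then have "nbrs G c \<subseteq> {a, b}" using sub[of c] irr[of c] uc unfolding True by blast
          then have "nbrs G c = {a, b}"
            using deg[OF cV(1)] card_seteq[of "{a, b}" "nbrs G c"] ne by simp
          then show ?thesis using cycle[of u c a b] True tri ne c cV by auto
        next
          case False
          show ?thesis
          proof (rule reduce_pair[of u a "{b, c}"])
            show "card {b, c} < 2 \<or> pverts G \<noteq> {u, a} \<union> {b, c}" using False by auto
          qed (use V cV tri(1) c ne(1-3) two in simp_all)
        qed
      qed
    qed
  qed
qed

section \<open>Real symmetric matrices\<close>

lemma scalar_prod_symmetric_mat:
  fixes A :: "'a :: comm_semiring_0 mat"
  assumes "A \<in> carrier_mat n n" "transpose_mat A = A" "x \<in> carrier_vec n" "y \<in> carrier_vec n"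
  shows "(A *\<^sub>v x) \<bullet> y = x \<bullet> (A *\<^sub>v y)"
  using transpose_vec_mult_scalar[of A n n y x] assms by (metis comm_scalar_prod mult_mat_vec_carrier)

text \<open>The Hermitian argument: moving the matrix across the scalar product of \<open>v\<close>
  and \<open>conjugate v\<close> shows that \<open>z\<close> and its conjugate agree, since that
  product is nonzero.\<close>

lemma real_symmetric_complex_eigenvalue:
  fixes A :: "real mat"
  assumes A: "A \<in> carrier_mat n n" "transpose_mat A = A"
    and e: "eigenvalue (map_mat complex_of_real A) z"
  shows "z \<in> \<real>"
proof -
  let ?A = "map_mat complex_of_real A"
  have cA: "?A \<in> carrier_mat n n" "transpose_mat ?A = ?A"
    using A by (auto simp: map_mat_transpose)
  obtain v where v: "v \<in> carrier_vec n" "v \<noteq> 0\<^sub>v n" "?A *\<^sub>v v = z \<cdot>\<^sub>v v"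
    using e A by (auto simp: eigenvalue_def eigenvector_def)
  have cc: "conjugate v \<in> carrier_vec n" using v by simp
  have row: "conjugate (row ?A i) = row ?A i" if "i < n" for i
    using A that by (intro eq_vecI) auto
  have "?A *\<^sub>v conjugate v = conjugate (?A *\<^sub>v v)"
  proof (rule eq_vecI)
    fix i assume "i < dim_vec (conjugate (?A *\<^sub>v v))"
    then have i: "i < n" using A by simp
    have "row ?A i \<bullet> conjugate v = conjugate (row ?A i \<bullet> v)"
      using conjugate_sprod_vec[of "row ?A i" n v] row[OF i] v A i by simp
    then show "(?A *\<^sub>v conjugate v) $ i = conjugate (?A *\<^sub>v v) $ i"
      using i A by simp
  qed (use A in simp)
  then have "(?A *\<^sub>v v) \<bullet> conjugate v = v \<bullet> conjugate (?A *\<^sub>v v)"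
    using scalar_prod_symmetric_mat[OF cA v(1) cc] by simp
  then have "z * (v \<bullet> conjugate v) = conjugate z * (v \<bullet> conjugate v)"
    using v cc by (simp add: conjugate_smult_vec)
  moreover have "v \<bullet> conjugate v \<noteq> 0"
    using v conjugate_square_eq_0_vec[of v n] by simp
  ultimately have "cnj z = z" by simp
  then show ?thesis by (metis Reals_cnj_iff)
qed

text \<open>An eigenvalue exists over the complex numbers and is real; as a root of the
  characteristic polynomial it is an eigenvalue of the real matrix too.\<close>

lemma real_symmetric_exists_eigenvalue:
  fixes A :: "real mat"
  assumes A: "A \<in> carrier_mat n n" "transpose_mat A = A" and n: "n > 0"
  shows "\<exists>e. eigenvalue A e"
proof -
  let ?A = "map_mat complex_of_real A"
  have cA: "?A \<in> carrier_mat n n" using A by simp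
  obtain z where z: "eigenvalue ?A z"
    using spectrum_non_empty[OF cA] n by (auto simp: spectrum_def)
  then obtain e where "z = complex_of_real e"
    using real_symmetric_complex_eigenvalue[OF A] by (auto elim: Reals_cases)
  with z have "eigenvalue ?A (complex_of_real e)" by simp
  then show ?thesis
    using eigenvalue_root_char_poly[OF cA] eigenvalue_root_char_poly[OF A(1)]
    by (auto simp: of_real_hom.char_poly_hom[OF A(1)])
qed

text \<open>Gram-Schmidt applied to a basis starting with \<open>v\<close> keeps its first vector;
  normalising gives orthonormal columns, the first still a multiple of \<open>v\<close>.\<close>

lemma exists_orthogonal_mat_first_col:
  fixes v :: "real vec"
  assumes v: "v \<in> carrier_vec n" "v \<noteq> 0\<^sub>v n"
  shows "\<exists>W c. W \<in> carrier_mat n n \<and> transpose_mat W * W = 1\<^sub>m n \<and> col W 0 = c \<cdot>\<^sub>v v"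
proof -
  interpret cof_vec_space n "TYPE(real)" .
  have n: "n > 0" using v by (cases n) auto
  define b where "b = basis_completion v"
  note b = basis_completion[OF v, folded b_def]
  define ws where "ws = gram_schmidt n b"
  note ws = gram_schmidt_result[OF b(2,4,5) ws_def]
  have len: "length ws = n" using ws b(6) by simp
  obtain vs where bv: "b = v # vs" using b(6,7) n by (cases b) auto
  have hd: "ws ! 0 = v"
    using gram_schmidt_hd[OF v(1), of vs, folded bv ws_def] len n by (metis hd_conv_nth length_0_conv not_less0)
  define us where "us = map (\<lambda>w. (1 / sqrt (w \<bullet> w)) \<cdot>\<^sub>v w) ws"
  define W where "W = mat_of_cols n us"
  have wc: "ws ! i \<in> carrier_vec n" if "i < n" for i using ws(3) len that by auto
  have W: "W \<in> carrier_mat n n" by (simp add: W_def us_def len mat_of_cols_carrier(1)[of n us, unfolded us_def length_map len])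
  have col: "col W i = (1 / sqrt (ws ! i \<bullet> ws ! i)) \<cdot>\<^sub>v (ws ! i)" if "i < n" for i
    using that wc[OF that] len by (simp add: W_def us_def)
  have conj: "conjugate w = w" for w :: "real vec" by (intro eq_vecI) auto
  have orth: "ws ! i \<bullet> ws ! j = 0 \<longleftrightarrow> i \<noteq> j" if "i < n" "j < n" for i j
    using corthogonalD[OF ws(2), of i j] that len conj by simp
  have pos: "ws ! i \<bullet> ws ! i > 0" if "i < n" for i
    using orth[OF that that] conjugate_square_ge_0_vec[of "ws ! i"] conj[of "ws ! i"] by simp
  have "transpose_mat W * W = 1\<^sub>m n"
  proof (rule eq_matI)
    fix i j assume "i < dim_row (1\<^sub>m n)" "j < dim_col (1\<^sub>m n)"
    then have ij: "i < n" "j < n" by auto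
    have "(transpose_mat W * W) $$ (i, j) = col W i \<bullet> col W j"
      using W ij by simp
    also have "\<dots> = (ws ! i \<bullet> ws ! j) / (sqrt (ws ! i \<bullet> ws ! i) * sqrt (ws ! j \<bullet> ws ! j))"
      using wc[OF ij(1)] wc[OF ij(2)] ij
      by (simp add: col smult_scalar_prod_distrib[of _ n] scalar_prod_smult_distrib[of _ n])
    also have "\<dots> = 1\<^sub>m n $$ (i, j)"
      using orth[OF ij] pos[OF ij(1)] ij by (cases "i = j") auto
    finally show "(transpose_mat W * W) $$ (i, j) = 1\<^sub>m n $$ (i, j)" .
  qed (use W in auto)
  with W col[OF n] hd show ?thesis by auto
qed

text \<open>Serves the spectral theorem twice: with the identity as \<open>X\<close> for the
  orthogonality of \<open>W * R\<close>, and with the given matrix for its diagonal form.\<close>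

lemma transpose_mult_congruence:
  fixes X :: "'a :: comm_ring_1 mat"
  assumes "W \<in> carrier_mat n n" "R \<in> carrier_mat n n" "X \<in> carrier_mat n n"
  shows "transpose_mat (W * R) * X * (W * R) = transpose_mat R * (transpose_mat W * X * W) * R"
proof -
  note W = assms(1) and R = assms(2) and X = assms(3)
  have Wt: "transpose_mat W \<in> carrier_mat n n" and Rt: "transpose_mat R \<in> carrier_mat n n"
    using W R by simp_all
  have WX: "transpose_mat W * X \<in> carrier_mat n n" using Wt X by simp
  have "transpose_mat (W * R) * X * (W * R) = transpose_mat R * (transpose_mat W * X) * (W * R)"
    by (simp only: transpose_mult[OF W R] assoc_mult_mat[OF Rt Wt X])
  also have "\<dots> = transpose_mat R * (transpose_mat W * X) * W * R"
    by (rule assoc_mult_mat[symmetric, OF mult_carrier_mat[OF Rt WX] W R])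
  also have "\<dots> = transpose_mat R * (transpose_mat W * X * W) * R"
    by (simp only: assoc_mult_mat[OF Rt WX W])
  finally show ?thesis .
qed

text \<open>An eigenvector as first column of an orthogonal \<open>W\<close> makes
  \<open>transpose_mat W * A * W\<close> vanish outside the corner in its first column and, by
  symmetry, in its first row. The remaining block is diagonalised by induction.\<close>

lemma real_spectral_theorem:
  fixes A :: "real mat"
  assumes "A \<in> carrier_mat n n" "transpose_mat A = A"
  shows "\<exists>Q D. Q \<in> carrier_mat n n \<and> D \<in> carrier_mat n n \<and> transpose_mat Q * Q = 1\<^sub>m n
    \<and> diagonal_mat D \<and> transpose_mat Q * A * Q = D"
  using assms
proof (induction n arbitrary: A)
  case 0
  then show ?case by (intro exI[of _ "1\<^sub>m 0"] exI[of _ A]) (auto simp: diagonal_mat_def)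
next
  case (Suc n)
  note A = Suc.prems
  obtain e where "eigenvalue A e" using real_symmetric_exists_eigenvalue[OF A] by auto
  then obtain v where v: "v \<in> carrier_vec (Suc n)" "v \<noteq> 0\<^sub>v (Suc n)" "A *\<^sub>v v = e \<cdot>\<^sub>v v"
    using A by (auto simp: eigenvalue_def eigenvector_def)
  obtain W c where W: "W \<in> carrier_mat (Suc n) (Suc n)" "transpose_mat W * W = 1\<^sub>m (Suc n)"
      "col W 0 = c \<cdot>\<^sub>v v"
    using exists_orthogonal_mat_first_col[OF v(1,2)] by blast
  let ?N = "Suc n"
  have Wt: "transpose_mat W \<in> carrier_mat ?N ?N" using W by simp
  define B where "B = transpose_mat W * A * W"
  have B: "B \<in> carrier_mat ?N ?N" using A W by (simp add: B_def)
  have Bs: "transpose_mat B = B"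
    using A W Wt by (simp add: B_def transpose_mult[of _ ?N ?N _ ?N] assoc_mult_mat[of _ ?N ?N _ ?N _ ?N])
  have B0: "B $$ (i, 0) = (if i = 0 then e else 0)" if i: "i < ?N" for i
  proof -
    have "A *\<^sub>v col W 0 = e \<cdot>\<^sub>v col W 0"
      using A v by (simp add: W(3) mult_mat_vec smult_smult_assoc mult.commute)
    moreover have "B $$ (i, 0) = col W i \<bullet> (A *\<^sub>v col W 0)"
    proof -
      have "B = transpose_mat W * (A * W)" unfolding B_def using A W Wt by (simp add: assoc_mult_mat[of _ ?N ?N _ ?N _ ?N])
      moreover have "A * W \<in> carrier_mat ?N ?N" using A W by simp
      ultimately have "B $$ (i, 0) = row (transpose_mat W) i \<bullet> col (A * W) 0"
        using i Wt by (metis carrier_matD index_mult_mat(1) zero_less_Suc)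
      moreover have "col (A * W) 0 = A *\<^sub>v col W 0"
        by (rule col_mult2[of A ?N ?N W ?N]) (use A W in auto)
      moreover have "row (transpose_mat W) i = col W i" using i W by simp
      ultimately show ?thesis by metis
    qed
    ultimately have "B $$ (i, 0) = e * (col W i \<bullet> col W 0)" using W(1) i by simp
    also have "col W i \<bullet> col W 0 = (transpose_mat W * W) $$ (i, 0)" using W(1) i by simp
    also have "\<dots> = (if i = 0 then 1 else 0)" using W(2) i by simp
    finally show ?thesis by simp
  qed
  have B0': "B $$ (0, i) = (if i = 0 then e else 0)" if i: "i < ?N" for i
    using B0[OF i] Bs i B by (metis carrier_matD index_transpose_mat(1) zero_less_Suc)
  define C where "C = mat n n (\<lambda>(i, j). B $$ (Suc i, Suc j))"
  have C: "C \<in> carrier_mat n n" by (simp add: C_def)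
  have Cs: "transpose_mat C = C"
  proof (rule eq_matI)
    fix i j assume "i < dim_row C" "j < dim_col C"
    then have ij: "i < n" "j < n" using C by auto
    have "B $$ (Suc j, Suc i) = transpose_mat B $$ (Suc i, Suc j)" using ij B by simp
    then show "transpose_mat C $$ (i, j) = C $$ (i, j)" using ij Bs by (simp add: C_def)
  qed (use C in auto)
  obtain P E where P: "P \<in> carrier_mat n n" "E \<in> carrier_mat n n" "transpose_mat P * P = 1\<^sub>m n"
      "diagonal_mat E" "transpose_mat P * C * P = E"
    using Suc.IH[OF C Cs] by blast
  define blk :: "real mat \<Rightarrow> real mat \<Rightarrow> real mat" where
    "blk X Y = four_block_mat X (0\<^sub>m 1 n) (0\<^sub>m n 1) Y" for X Y
  have blk_carrier: "blk X Y \<in> carrier_mat ?N ?N"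
    if "X \<in> carrier_mat 1 1" "Y \<in> carrier_mat n n" for X Y
    using four_block_carrier_mat[OF that] by (simp add: blk_def)
  have blk_mult: "blk X Y * blk X' Y' = blk (X * X') (Y * Y')"
    if "X \<in> carrier_mat 1 1" "Y \<in> carrier_mat n n" "X' \<in> carrier_mat 1 1" "Y' \<in> carrier_mat n n" for X Y X' Y'
    using that by (simp add: blk_def
        mult_four_block_mat[OF that(1) zero_carrier_mat zero_carrier_mat that(2) that(3) zero_carrier_mat zero_carrier_mat that(4)]
        del: One_nat_def)
  have blk_transpose: "transpose_mat (blk X Y) = blk (transpose_mat X) (transpose_mat Y)"
    if "X \<in> carrier_mat 1 1" "Y \<in> carrier_mat n n" for X Y
    using that by (simp add: blk_def transpose_four_block_mat[OF that(1) zero_carrier_mat zero_carrier_mat that(2)]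
        del: One_nat_def)
  let ?e = "mat 1 1 (\<lambda>_. e)"
  have Bblk: "B = blk ?e C"
    by (rule eq_matI) (use B C B0 B0' in \<open>auto simp: blk_def C_def less_Suc_eq_0_disj\<close>)
  have one: "blk (1\<^sub>m 1) (1\<^sub>m n) = 1\<^sub>m ?N"
    by (rule eq_matI) (auto simp: blk_def)
  let ?R = "blk (1\<^sub>m 1) P"
  have R: "?R \<in> carrier_mat ?N ?N" using blk_carrier P by simp
  have Rt: "transpose_mat ?R = blk (1\<^sub>m 1) (transpose_mat P)" using P by (simp add: blk_transpose)
  have RR: "transpose_mat ?R * ?R = 1\<^sub>m ?N"
    using P by (simp add: Rt blk_mult one del: One_nat_def)
  have RBR: "transpose_mat ?R * B * ?R = blk ?e E"
    unfolding Bblk Rt using P C by (simp add: blk_mult del: One_nat_def)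
  define Q where "Q = W * ?R"
  have Q: "Q \<in> carrier_mat ?N ?N" using W R by (simp add: Q_def)
  have "transpose_mat Q * Q = transpose_mat ?R * (transpose_mat W * W) * ?R"
    using transpose_mult_congruence[OF W(1) R one_carrier_mat] W(1) R Q
    by (simp add: Q_def[symmetric] del: One_nat_def)
  then have "transpose_mat Q * Q = 1\<^sub>m ?N" using W(2) RR R by (simp del: One_nat_def)
  moreover have "transpose_mat Q * A * Q = transpose_mat ?R * B * ?R"
    unfolding Q_def B_def by (rule transpose_mult_congruence[OF W(1) R A(1)])
  moreover have "diagonal_mat (blk ?e E)"
    unfolding diagonal_mat_def
  proof (intro allI impI)
    fix i j assume "i < dim_row (blk ?e E)" "j < dim_col (blk ?e E)" "i \<noteq> j"
    then show "blk ?e E $$ (i, j) = 0"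
      using P(2,4) by (cases i; cases j) (auto simp: blk_def diagonal_mat_def)
  qed
  ultimately show ?case
    using Q RBR blk_carrier[of ?e E] P(2)
    by (intro exI[of _ Q] exI[of _ "blk ?e E"]) (simp del: One_nat_def)
qed

section \<open>Eigenvalue counts from form bounds on subspaces\<close>

text \<open>Zero rows pad the system to a square matrix; as there are fewer than \<open>n\<close>
  equations, its last row vanishes and it is singular.\<close>

lemma exists_nonzero_orthogonal_vec:
  fixes rs :: "real vec list"
  assumes "length rs < n" "set rs \<subseteq> carrier_vec n"
  shows "\<exists>x \<in> carrier_vec n. x \<noteq> 0\<^sub>v n \<and> (\<forall>r \<in> set rs. r \<bullet> x = 0)"
proof -
  define M where "M = mat n n (\<lambda>(i, j). if i < length rs then rs ! i $ j else 0)"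
  have M: "M \<in> carrier_mat n n" by (simp add: M_def)
  have "row M (n - 1) = 0\<^sub>v n"
    using assms(1) by (intro eq_vecI) (auto simp: M_def)
  then have "det M = 0"
    using laplace_expansion_row[OF M, of "n - 1"] assms(1) M
    by (auto simp: M_def intro!: sum.neutral)
  then obtain x where x: "x \<in> carrier_vec n" "x \<noteq> 0\<^sub>v n" "M *\<^sub>v x = 0\<^sub>v n"
    using det_0_iff_vec_prod_zero_field[OF M] by blast
  have "r \<bullet> x = 0" if "r \<in> set rs" for r
  proof -
    obtain i where i: "i < length rs" "rs ! i = r" using \<open>r \<in> set rs\<close> by (auto simp: in_set_conv_nth)
    have "row M i = r"
      using i assms that by (intro eq_vecI) (auto simp: M_def)
    moreover have "(M *\<^sub>v x) $ i = 0" using x(3) i assms(1) by simp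
    ultimately show ?thesis using i assms(1) M by simp
  qed
  with x show ?thesis by blast
qed

lemma proots_prod_linear_factors:
  "proots (\<Prod>a\<leftarrow>as. [:- a, 1:]) = mset (as :: real list)"
proof (induction as)
  case (Cons a as)
  have "(\<Prod>a\<leftarrow>as. [:- a, 1:]) \<noteq> 0" by (auto simp: prod_list_zero_iff)
  then have "proots ([:- a, 1:] * (\<Prod>a\<leftarrow>as. [:- a, 1:])) = proots [:- a, 1:] + proots (\<Prod>a\<leftarrow>as. [:- a, 1:])"
    by (intro proots_mult) auto
  then show ?case using Cons.IH by simp
qed simp

lemma real_symmetric_diagonalization:
  fixes A :: "real mat"
  assumes A: "A \<in> carrier_mat n n" "transpose_mat A = A"
  obtains Q D where "Q \<in> carrier_mat n n" "D \<in> carrier_mat n n" "transpose_mat Q * Q = 1\<^sub>m n"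
    "diagonal_mat D" "A = Q * D * transpose_mat Q" "proots (char_poly A) = mset (diag_mat D)"
proof -
  obtain Q D where Q: "Q \<in> carrier_mat n n" "D \<in> carrier_mat n n" "transpose_mat Q * Q = 1\<^sub>m n"
    "diagonal_mat D" "transpose_mat Q * A * Q = D"
    using real_spectral_theorem[OF A] by blast
  have Qt: "transpose_mat Q \<in> carrier_mat n n" using Q by simp
  have QQ: "Q * transpose_mat Q = 1\<^sub>m n"
    using mat_mult_left_right_inverse[OF Qt Q(1) Q(3)] .
  have "Q * D * transpose_mat Q = (Q * transpose_mat Q) * A * (Q * transpose_mat Q)"
    unfolding Q(5)[symmetric] using Q(1) Qt A(1) by (simp add: assoc_mult_mat[of _ n n _ n _ n])
  then have AQ: "A = Q * D * transpose_mat Q" using QQ A by simp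
  have "similar_mat A D"
    by (rule similar_matI[of _ _ Q "transpose_mat Q" n]) (use A Q Qt QQ AQ in auto)
  then have "char_poly A = char_poly D" by (rule char_poly_similar)
  also have "\<dots> = (\<Prod>a\<leftarrow>diag_mat D. [:- a, 1:])"
    by (rule char_poly_upper_triangular[OF Q(2)])
      (use Q in \<open>auto simp: diagonal_mat_def upper_triangular_def\<close>)
  finally have "proots (char_poly A) = mset (diag_mat D)"
    by (simp add: proots_prod_linear_factors)
  with that Q AQ show thesis by blast
qed

text \<open>All roots of the characteristic polynomial are real, so the sorted list behind
  \<open>graph_lambda\<close> has one entry for every vertex.\<close>

lemma size_proots_char_poly_symmetric:
  fixes A :: "real mat"
  assumes A: "A \<in> carrier_mat n n" "transpose_mat A = A"
  shows "size (proots (char_poly A)) = n"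
proof (rule real_symmetric_diagonalization[OF A])
  fix Q D :: "real mat"
  assume "D \<in> carrier_mat n n" "proots (char_poly A) = mset (diag_mat D)"
  then show ?thesis by (simp add: diag_mat_def)
qed

text \<open>A dimension count in the manner of Courant and Fischer. If more than
  \<open>length rs\<close> eigenvalues satisfied \<open>s * e > 1\<close>, some nonzero combination
  of their eigenvectors would be orthogonal to all of \<open>rs\<close> and violate the form
  bound.\<close>

lemma count_eigenvalues_le_codimension:
  fixes A :: "real mat" and rs :: "real vec list"
  assumes A: "A \<in> carrier_mat n n" "transpose_mat A = A"
    and rs: "set rs \<subseteq> carrier_vec n"
    and form: "\<And>x. x \<in> carrier_vec n \<Longrightarrow> (\<And>r. r \<in> set rs \<Longrightarrow> r \<bullet> x = 0) \<Longrightarrow> s * (x \<bullet> (A *\<^sub>v x)) \<le> x \<bullet> x"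
  shows "size {#e \<in># proots (char_poly A). s * e > 1#} \<le> length rs"
proof (rule real_symmetric_diagonalization[OF A])
  fix Q D
  assume Q: "Q \<in> carrier_mat n n" "D \<in> carrier_mat n n" "transpose_mat Q * Q = 1\<^sub>m n"
    and D: "diagonal_mat D" and AQ: "A = Q * D * transpose_mat Q"
    and roots: "proots (char_poly A) = mset (diag_mat D)"
  define d where "d j = D $$ (j, j)" for j
  define P where "P = (\<lambda>j. s * d j > 1)"
  have Qt: "transpose_mat Q \<in> carrier_mat n n" using Q by simp
  have dm: "diag_mat D = map d [0..<n]" using Q by (auto simp: diag_mat_def d_def)
  have size: "size {#e \<in># proots (char_poly A). s * e > 1#} = length (filter P [0..<n])"
    unfolding roots dm by (simp add: mset_filter[symmetric] filter_map o_def P_def del: mset_filter mset_map)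
  show ?thesis
  proof (rule ccontr)
    assume "\<not> ?thesis"
    then have less: "length rs < length (filter P [0..<n])" using size by simp
    \<comment> \<open>In eigenbasis coordinates \<open>y\<close>, the conditions are orthogonality
      to the transformed vectors of \<open>rs\<close> and vanishing at every index outside
      \<open>P\<close>.\<close>
    define ys where "ys = map (\<lambda>r. transpose_mat Q *\<^sub>v r) rs
      @ map (unit_vec n) (filter (\<lambda>j. \<not> P j) [0..<n])"
    have "length (filter P [0..<n]) + length (filter (\<lambda>j. \<not> P j) [0..<n]) = n"
      using sum_length_filter_compl[of P "[0..<n]"] by simp
    with less have "length ys < n" by (simp add: ys_def)
    moreover have "set ys \<subseteq> carrier_vec n" using Qt rs by (auto simp: ys_def)
    ultimately obtain y where y: "y \<in> carrier_vec n" "y \<noteq> 0\<^sub>v n" and orth: "\<forall>r \<in> set ys. r \<bullet> y = 0"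
      using exists_nonzero_orthogonal_vec by blast
    have y0: "y $ j = 0" if "j < n" "\<not> P j" for j
    proof -
      have "unit_vec n j \<in> set ys" using that by (auto simp: ys_def)
      then show ?thesis using orth y that by (metis scalar_prod_left_unit)
    qed
    define x where "x = Q *\<^sub>v y"
    have x: "x \<in> carrier_vec n" using Q y by (simp add: x_def)
    have Qx: "transpose_mat Q *\<^sub>v x = y"
      unfolding x_def using Q Qt y by (metis assoc_mult_mat_vec one_mult_mat_vec)
    have tr: "v \<bullet> (Q *\<^sub>v u) = (transpose_mat Q *\<^sub>v v) \<bullet> u" if "v \<in> carrier_vec n" "u \<in> carrier_vec n" for u v
      by (rule transpose_vec_mult_scalar[OF Q(1) that(2,1), symmetric])
    have "r \<bullet> x = 0" if "r \<in> set rs" for r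
    proof -
      have "transpose_mat Q *\<^sub>v r \<in> set ys" using that by (auto simp: ys_def)
      moreover have "r \<in> carrier_vec n" using that rs by blast
      ultimately show ?thesis using orth tr[of r y] y by (simp add: x_def)
    qed
    then have le: "s * (x \<bullet> (A *\<^sub>v x)) \<le> x \<bullet> x" using form[OF x] by blast
    have xx: "x \<bullet> x = (\<Sum>j<n. (y $ j)\<^sup>2)"
    proof -
      have "x \<bullet> x = y \<bullet> y" using tr[OF x y(1)] Qx by (simp add: x_def[symmetric])
      then show ?thesis using y by (simp add: scalar_prod_def power2_eq_square lessThan_atLeast0)
    qed
    have "A *\<^sub>v x = Q *\<^sub>v (D *\<^sub>v y)"
      unfolding AQ using Q Qt x Qx y by (simp add: assoc_mult_mat_vec[of _ n n _ n])
    moreover have Dy: "D *\<^sub>v y \<in> carrier_vec n" using Q y by simp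
    ultimately have "x \<bullet> (A *\<^sub>v x) = y \<bullet> (D *\<^sub>v y)" using tr[OF x Dy] Qx by simp
    moreover have "(D *\<^sub>v y) $ j = d j * y $ j" if "j < n" for j
    proof -
      have "(D *\<^sub>v y) $ j = (\<Sum>i<n. D $$ (j, i) * y $ i)"
        using that Q y by (simp add: scalar_prod_def lessThan_atLeast0)
      also have "\<dots> = (\<Sum>i<n. if i = j then d j * y $ j else 0)"
        by (rule sum.cong) (use that D Q in \<open>auto simp: diagonal_mat_def d_def\<close>)
      also have "\<dots> = d j * y $ j" using that by simp
      finally show ?thesis .
    qed
    moreover have "y \<bullet> (D *\<^sub>v y) = (\<Sum>j<n. y $ j * (D *\<^sub>v y) $ j)"
      unfolding scalar_prod_def carrier_vecD[OF Dy] lessThan_atLeast0 ..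
    ultimately have xAx: "x \<bullet> (A *\<^sub>v x) = (\<Sum>j<n. d j * (y $ j)\<^sup>2)"
      by (simp add: power2_eq_square ac_simps)
    \<comment> \<open>Every summand is nonnegative: indices in \<open>P\<close> have a positive
      factor, the others have \<open>y $ j = 0\<close>. A sum that is at most \<open>0\<close> thus
      forces \<open>y = 0\<close>.\<close>
    have "(\<Sum>j<n. (s * d j - 1) * (y $ j)\<^sup>2)
        = s * (\<Sum>j<n. d j * (y $ j)\<^sup>2) - (\<Sum>j<n. (y $ j)\<^sup>2)"
      unfolding sum_distrib_left sum_subtractf[symmetric]
      by (rule sum.cong) (simp_all add: left_diff_distrib mult.assoc)
    then have "(\<Sum>j<n. (s * d j - 1) * (y $ j)\<^sup>2) \<le> 0" using le by (simp only: xx xAx)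
    moreover have nn: "0 \<le> (s * d j - 1) * (y $ j)\<^sup>2" if "j < n" for j
      using y0[OF that] by (cases "P j") (auto simp: P_def)
    ultimately have "(\<Sum>j<n. (s * d j - 1) * (y $ j)\<^sup>2) = 0"
      by (intro antisym sum_nonneg) auto
    then have "\<forall>j \<in> {..<n}. (s * d j - 1) * (y $ j)\<^sup>2 = 0"
      by (subst (asm) sum_nonneg_eq_0_iff) (use nn in auto)
    then have z: "(s * d j - 1) * (y $ j)\<^sup>2 = 0" if "j < n" for j
      using that by blast
    have "y $ j = 0" if "j < n" for j
      using z[OF that] y0[OF that] by (cases "P j") (auto simp: P_def)
    then have "y = 0\<^sub>v n" using y by (intro eq_vecI) auto
    with y show False by simp
  qed
qed

section \<open>From eigenvalue counts to the middle eigenvalues\<close>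

lemma length_filter_ge_drop:
  assumes "\<And>x. x \<in> set (drop i xs) \<Longrightarrow> P x"
  shows "length xs - i \<le> length (filter P xs)"
proof -
  have "filter P xs = filter P (take i xs) @ filter P (drop i xs)"
    by (metis append_take_drop_id filter_append)
  moreover have "filter P (drop i xs) = drop i xs" using assms by simp
  ultimately show ?thesis by (metis le_add2 length_append length_drop)
qed

lemma length_filter_ge_take:
  assumes "\<And>x. x \<in> set (take i xs) \<Longrightarrow> P x" "i \<le> length xs"
  shows "i \<le> length (filter P xs)"
proof -
  have "filter P xs = filter P (take i xs) @ filter P (drop i xs)"
    by (metis append_take_drop_id filter_append)
  moreover have "filter P (take i xs) = take i xs" using assms by simp
  ultimately show ?thesis using assms(2) by simp
qed

text \<open>Let \<open>n\<close> be the number of vertices. Were the \<open>h\<close>-th largest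
  eigenvalue above \<open>1\<close>, at least \<open>h\<close> would be, although
  \<open>2 * h >= n\<close>; were the \<open>l\<close>-th below \<open>-1\<close>, at least
  \<open>n - l + 1\<close> would be, although \<open>2 * (n - l + 1) >= n\<close>. As the
  \<open>l\<close>-th is at most the \<open>h\<close>-th, both lie between \<open>-1\<close> and
  \<open>1\<close>.\<close>

lemma HL_index_le_1:
  assumes n: "card (pverts G) > 0" and size: "size (graph_eigenvalues G) = card (pverts G)"
    and upper: "2 * size {#e \<in># graph_eigenvalues G. e > 1#} < card (pverts G)"
    and lower: "2 * size {#e \<in># graph_eigenvalues G. e < -1#} < card (pverts G)"
  shows "HL_index G \<le> 1"
proof -
  let ?n = "card (pverts G)"
  define S where "S = sorted_list_of_multiset (graph_eigenvalues G)"
  have S: "sorted S" "mset S = graph_eigenvalues G" by (simp_all add: S_def)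
  have len: "length S = ?n" using S size by (metis size_mset)
  have cnt: "size {#e \<in># graph_eigenvalues G. P e#} = length (filter P S)" for P
    by (metis S(2) mset_filter size_mset)
  define h where "h = (?n + 1) div 2"
  \<comment> \<open>Division by \<open>2\<close> rounds down, so the ceiling of
    \<open>(n + 1) / 2\<close> takes the numerator \<open>n + 2\<close>.\<close>
  define l where "l = (?n + 2) div 2"
  have hl: "1 \<le> h" "h \<le> l" "l \<le> ?n" using n by (auto simp: h_def l_def)
  have lam: "graph_lambda G k = S ! (?n - k)" if "1 \<le> k" "k \<le> ?n" for k
    using that len unfolding graph_lambda_def S_def[symmetric] by (simp add: rev_nth)
  have "2 * h \<le> ?n + 1" "?n + 1 \<le> 2 * h + 1" "2 * l \<le> ?n + 2" "?n + 2 \<le> 2 * l + 1"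
    by (simp_all add: h_def l_def)
  then have hl': "2 * real h \<le> real ?n + 1" "real ?n + 1 \<le> 2 * real h + 1"
      "2 * real l \<le> real ?n + 2" "real ?n + 2 \<le> 2 * real l + 1"
    by linarith+
  have "\<lfloor>(real ?n + 1) / 2\<rfloor> = int h"
    by (rule floor_unique) (use hl' in auto)
  moreover have "\<lceil>(real ?n + 1) / 2\<rceil> = int l"
    by (rule ceiling_unique) (use hl' in auto)
  ultimately have HL: "HL_index G = max \<bar>S ! (?n - h)\<bar> \<bar>S ! (?n - l)\<bar>"
    using lam hl by (simp add: HL_index_def Let_def)
  have "S ! (?n - h) \<le> 1"
  proof (rule ccontr)
    assume *: "\<not> ?thesis"
    have "x > 1" if x: "x \<in> set (drop (?n - h) S)" for x
    proof -
      obtain i where "i < length (drop (?n - h) S)" "drop (?n - h) S ! i = x"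
        using x unfolding in_set_conv_nth by blast
      then have "?n - h + i < ?n" "x = S ! (?n - h + i)" using len by auto
      then have "S ! (?n - h) \<le> x" using sorted_nth_mono[OF S(1), of "?n - h" "?n - h + i"] len by simp
      with * show ?thesis by simp
    qed
    then have "h \<le> length (filter (\<lambda>x. x > 1) S)"
      using length_filter_ge_drop[of "?n - h" S "\<lambda>x. x > 1"] len hl by simp
    with upper cnt[of "\<lambda>e. e > 1"] show False by (simp add: h_def)
  qed
  moreover have "S ! (?n - l) \<ge> -1"
  proof (rule ccontr)
    assume *: "\<not> ?thesis"
    have "x < -1" if x: "x \<in> set (take (?n - l + 1) S)" for x
    proof -
      obtain i where "i \<le> ?n - l" "i < ?n" "x = S ! i"
        using x len by (auto simp: in_set_conv_nth less_Suc_eq_le)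
      then have "x \<le> S ! (?n - l)" using sorted_nth_mono[OF S(1), of i "?n - l"] len hl by simp
      with * show ?thesis by simp
    qed
    then have "?n - l + 1 \<le> length (filter (\<lambda>x. x < -1) S)"
      using length_filter_ge_take[of "?n - l + 1" S "\<lambda>x. x < -1"] len hl by simp
    with lower cnt[of "\<lambda>e. e < -1"] hl show False by (simp add: l_def)
  qed
  moreover have "S ! (?n - l) \<le> S ! (?n - h)"
    using sorted_nth_mono[OF S(1), of "?n - l" "?n - h"] len hl by simp
  ultimately show ?thesis unfolding HL by linarith
qed

section \<open>Eigenvalues of subcubic \<open>K\<^sub>4\<close>-minor-free graphs\<close>

lemma adjacency_matrix_carrier:
  "adjacency_matrix vs G \<in> carrier_mat (length vs) (length vs)"
  by (simp add: adjacency_matrix_def)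

lemma transpose_adjacency_matrix:
  assumes "pair_graph G"
  shows "transpose_mat (adjacency_matrix vs G) = adjacency_matrix vs G"
proof (rule eq_matI)
  fix i j
  assume "i < dim_row (adjacency_matrix vs G)" "j < dim_col (adjacency_matrix vs G)"
  moreover have "(a, b) \<in> parcs G \<longleftrightarrow> (b, a) \<in> parcs G" for a b
    using nbrs_sym[OF assms] by (simp add: mem_nbrs)
  ultimately show "transpose_mat (adjacency_matrix vs G) $$ (i, j) = adjacency_matrix vs G $$ (i, j)"
    by (simp add: adjacency_matrix_def)
qed (simp_all add: adjacency_matrix_def)

text \<open>The enumeration \<open>vs\<close> turns functions on vertices into vectors, the
  functionals into \<open>rs\<close>, and \<open>adj_form\<close> into the quadratic form of the
  adjacency matrix.\<close>

lemma count_graph_eigenvalues_le: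
  assumes G: "pair_graph G" and vs: "distinct vs" "set vs = pverts G"
    and bd: "form_bounded_codim s G k"
  shows "size {#e \<in># graph_eigenvalues G. s * e > 1#} \<le> k"
proof -
  define n where "n = length vs"
  define A where "A = adjacency_matrix vs G"
  have A: "A \<in> carrier_mat n n" "transpose_mat A = A"
    unfolding A_def n_def by (rule adjacency_matrix_carrier, rule transpose_adjacency_matrix[OF G])
  have bij: "bij_betw ((!) vs) {..<n} (pverts G)"
    using bij_betw_nth[OF vs(1)] vs(2) by (simp add: n_def)
  have sum_vs: "(\<Sum>v \<in> pverts G. h v) = (\<Sum>i<n. h (vs ! i))" for h :: "'a \<Rightarrow> real"
    using sum.reindex_bij_betw[OF bij, of h] by simp
  obtain L :: "('a \<Rightarrow> real) set" where L: "finite L" "card L \<le> k"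
    "\<forall>x. (\<forall>l \<in> L. (\<Sum>v \<in> pverts G. l v * x v) = 0)
      \<longrightarrow> s * adj_form G x \<le> (\<Sum>v \<in> pverts G. (x v)\<^sup>2)"
    using bd unfolding form_bounded_codim_def by (elim exE conjE)
  obtain ls where ls: "set ls = L" "distinct ls"
    using finite_distinct_list[OF L(1)] by blast
  define rs where "rs = map (\<lambda>l. vec n (\<lambda>i. l (vs ! i))) ls"
  have "size {#e \<in># proots (char_poly A). s * e > 1#} \<le> length rs"
  proof (rule count_eigenvalues_le_codimension[OF A])
    show "set rs \<subseteq> carrier_vec n" by (auto simp: rs_def)
    fix x :: "real vec"
    assume x: "x \<in> carrier_vec n" and orth: "\<And>r. r \<in> set rs \<Longrightarrow> r \<bullet> x = 0"
    define f where "f v = x $ the_inv_into {..<n} ((!) vs) v" for v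
    have f: "f (vs ! i) = x $ i" if "i < n" for i
      using that bij by (simp add: f_def bij_betw_def the_inv_into_f_f)
    have "(\<Sum>v \<in> pverts G. l v * f v) = 0" if "l \<in> L" for l
    proof -
      have "vec n (\<lambda>i. l (vs ! i)) \<bullet> x = 0"
        by (rule orth) (use that ls in \<open>auto simp: rs_def\<close>)
      then show ?thesis using x f by (simp add: sum_vs scalar_prod_def lessThan_atLeast0)
    qed
    then have "s * adj_form G f \<le> (\<Sum>v \<in> pverts G. (f v)\<^sup>2)" using L(3) by blast
    moreover have "(\<Sum>v \<in> pverts G. (f v)\<^sup>2) = x \<bullet> x"
      using x f by (simp add: sum_vs scalar_prod_def lessThan_atLeast0 power2_eq_square)
    moreover have "adj_form G f = x \<bullet> (A *\<^sub>v x)"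
    proof -
      have fV: "finite (pverts G)" using G pair_graph_iff by metis
      have "adj_form G f
          = (\<Sum>u \<in> pverts G. \<Sum>v \<in> pverts G. if (u, v) \<in> parcs G then f u * f v else 0)"
        unfolding adj_form_eq_sum_nbrs[OF G]
      proof (rule sum.cong[OF refl])
        fix u
        have "nbrs G u = {v \<in> pverts G. (u, v) \<in> parcs G}"
          using nbrs_subset[OF G, of u] by (auto simp: nbrs_def)
        then show "(\<Sum>v \<in> nbrs G u. f u * f v)
            = (\<Sum>v \<in> pverts G. if (u, v) \<in> parcs G then f u * f v else 0)"
          using sum.inter_filter[OF fV] by simp
      qed
      also have "\<dots> = (\<Sum>i<n. \<Sum>j<n. x $ i * (A $$ (i, j) * x $ j))"
        unfolding sum_vs
        by (intro sum.cong refl) (simp add: f A_def adjacency_matrix_def n_def[symmetric])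
      also have "\<dots> = (\<Sum>i<n. x $ i * (A *\<^sub>v x) $ i)"
        by (intro sum.cong refl)
          (use A x in \<open>simp add: scalar_prod_def lessThan_atLeast0 sum_distrib_left\<close>)
      also have "\<dots> = x \<bullet> (A *\<^sub>v x)"
        using A by (simp add: scalar_prod_def lessThan_atLeast0)
      finally show ?thesis .
    qed
    ultimately show "s * (x \<bullet> (A *\<^sub>v x)) \<le> x \<bullet> x" by simp
  qed
  also have "length rs = card L" using ls by (simp add: rs_def distinct_card[symmetric])
  finally show ?thesis
    using L(2) graph_eigenvalues_eq[OF vs] by (simp add: A_def)
qed

theorem theorem1p3:
  fixes G :: "'a pair_pre_digraph"
  assumes "pair_graph G"
    and "pverts G \<noteq> {}"
    and "subcubic G"
    and "K4_minor_free G"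
  shows "HL_index G \<le> 1"
proof (rule HL_index_le_1)
  have fV: "finite (pverts G)" using assms(1) pair_graph_iff by metis
  then show "card (pverts G) > 0" using assms(2) by (simp add: card_gt_0_iff)
  obtain vs where vs: "distinct vs" "set vs = pverts G"
    using finite_distinct_list[OF fV] by blast
  show "size (graph_eigenvalues G) = card (pverts G)"
    using size_proots_char_poly_symmetric[OF adjacency_matrix_carrier transpose_adjacency_matrix[OF assms(1)]]
      graph_eigenvalues_eq[OF vs] distinct_card[OF vs(1)] vs(2) by metis
  have cubic: "card (nbrs G v) \<le> 3" if "v \<in> pverts G" for v
    using assms(3) that by (simp add: subcubic_def out_degree_eq_card_nbrs)
  have count: "2 * size {#e \<in># graph_eigenvalues G. s * e > 1#} < card (pverts G)"
    if s: "\<bar>s\<bar> = 1" for s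
  proof -
    obtain k where k: "form_bounded_codim s G k" "2 * k < card (pverts G)"
      using subcubic_form_bounded[OF assms(1,2,4) cubic s] by blast
    show ?thesis using count_graph_eigenvalues_le[OF assms(1) vs k(1)] k(2) by simp
  qed
  show "2 * size {#e \<in># graph_eigenvalues G. e > 1#} < card (pverts G)"
    using count[of 1] by simp
  have "-1 * e > 1 \<longleftrightarrow> e < -1" for e :: real by auto
  then show "2 * size {#e \<in># graph_eigenvalues G. e < -1#} < card (pverts G)"
    using count[of "-1"] by (simp only: abs_minus_cancel abs_one)
qed

end
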